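(* Let $\mathcal{K}$ be a 2-category and let $(\mathbf{P},\mathbf{S},\upsilon)$ be a KZ context on $\mathcal{K}$. Then the following conditions are equivalent for an object $A\in\mathcal{K}$: (1) $A$ is $\mathbf{P}$-cocomplete and $\upsilon$-accessible; (2) $A$ is $\upsilon$-presentable.
   Context: Left extensions. In a 2-category $\mathcal{K}$, a left extension of $f:A\to C$ along $j:A\to B$ is a 1-cell $\mathrm{lan}_j f:B\to C$ with a 2-cell $\eta:f\Rightarrow(\mathrm{lan}_j f)\,j$ such that for every $g:B\to C$ pasting with $\eta$ is a bijection between 2-cells $\mathrm{lan}_jf\Rightarrow g$ and 2-cells $f\Rightarrow gj$. A 1-cell $k:C\to D$ preserves it if $k\eta$ exhibits $k\,\mathrm{lan}_jf$ as a left extension of $kf$ along $j$. KZ doctrines. A KZ doctrine (or doctrine) $(\mathbf{S},\sigma)$ on $\mathcal{K}$ consists of a function $A\mapsto\mathbf{S}A$ on objects, a 1-cell (unit) $\sigma_A:A\to\mathbf{S}A$ for each object $A$, and for each $f:A\to\mathbf{S}B$ a left extension $\bar f:\mathbf{S}A\to\mathbf{S}B$ of $f$ along $\sigma_A$, exhibited by an invertible 2-cell $c_f:f\Rightarrow\bar f\sigma_A$, such that: the left extension of $\sigma_A$ along $\sigma_A$ is $\mathrm{id}_{\mathbf{S}A}$ with the identity 2-cell; and for every $g:B\to\mathbf{S}C$, the 1-cell $\bar g:\mathbf{S}B\to\mathbf{S}C$ preserves the left extension $\bar f$ of every $f:A\to\mathbf{S}B$. For $f:A\to B$ put $\mathbf{S}_!f:=\mathrm{lan}_{\sigma_A}(\sigma_Bf):\mathbf{S}A\to\mathbf{S}B$.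 Cocompleteness. An object $X$ is $\mathbf{S}$-cocomplete if every $g:B\to X$ has a left extension $\bar g:\mathbf{S}B\to X$ along $\sigma_B$ exhibited by an invertible 2-cell, and $\bar g$ preserves the left extension $\bar f:\mathbf{S}A\to\mathbf{S}B$ along $\sigma_A$ of every $f:A\to\mathbf{S}B$. A 1-cell $E:X\to Y$ between $\mathbf{S}$-cocomplete objects is $\mathbf{S}$-cocontinuous if it preserves all left extensions along $\sigma_B$ into $X$, for every object $B$. Fully faithful. A 1-cell $i:A\to B$ is (representably) fully faithful if $i\circ-:\mathcal{K}(X,A)\to\mathcal{K}(X,B)$ is fully faithful for every object $X$. Admissibility. A 1-cell $f:A\to B$ is $\mathbf{S}$-admissible if there is a left extension $N_f:B\to\mathbf{S}A$ of $\sigma_A$ along $f$, and this left extension is preserved by the extension $\bar h:\mathbf{S}A\to X$ along $\sigma_A$ of every $h:A\to X$ with $X$ $\mathbf{S}$-cocomplete. An object $A$ is $\mathbf{S}$-petit if every 1-cell with domain $A$ is $\mathbf{S}$-admissible. KZ contexts. A KZ context $(\mathbf{P},\mathbf{S},\upsilon)$ on $\mathcal{K}$ consists of two doctrines $(\mathbf{P},y)$ and $(\mathbf{S},\sigma)$ on $\mathcal{K}$ such that: all unit components $y_A:A\to\mathbf{P}A$ and $\sigma_A:A\to\mathbf{S}A$ are fully faithful; every $\mathbf{P}A$ is $\mathbf{S}$-cocomplete and, for every $f:A\to B$, the 1-cell $\mathbf{P}_!f=\mathrm{lan}_{y_A}(y_Bf)$ is $\mathbf{S}$-cocontinuous; and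 the 1-cell $\upsilon_A:=\mathrm{lan}_{\sigma_A}(y_A):\mathbf{S}A\to\mathbf{P}A$ is fully faithful for every $A$. Accessible and presentable objects. An object $A$ is $\upsilon$-accessible if there is a $\mathbf{P}$-petit object $G$ with $A\simeq\mathbf{S}G$. An object $A$ is $\upsilon$-presentable if it is $\upsilon$-accessible and there are a $\mathbf{P}$-petit object $G$ and an adjunction $L\dashv i$ with $L:\mathbf{P}G\to A$ and $i:A\to\mathbf{P}G$, where $i$ is fully faithful and $\mathbf{S}$-cocontinuous. *)

theory Defs
  imports Main
begin

section \<open>Strict 2-categories\<close>

text \<open>
  Objects, 1-cells and 2-cells live in three types, cut out by carrier sets. Compositions are
  total functions that are constrained only on composable arguments.
\<close>

record ('o, 'm, 'c) twocat =
  Obj   :: "'o set"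
  Arr   :: "'m set"
  Cell  :: "'c set"
  src   :: "'m \<Rightarrow> 'o"
  trg   :: "'m \<Rightarrow> 'o"
  dom2  :: "'c \<Rightarrow> 'm"
  cod2  :: "'c \<Rightarrow> 'm"
  idn   :: "'o \<Rightarrow> 'm"
  comp  :: "'m \<Rightarrow> 'm \<Rightarrow> 'm"  (infixr "\<odot>\<index>" 70)
  id2   :: "'m \<Rightarrow> 'c"
  vcomp :: "'c \<Rightarrow> 'c \<Rightarrow> 'c"  (infixr "\<bullet>\<index>" 65)
  hcomp :: "'c \<Rightarrow> 'c \<Rightarrow> 'c"  (infixr "\<star>\<index>" 70)

definition hom1 :: "('o, 'm, 'c, 'x) twocat_scheme \<Rightarrow> 'o \<Rightarrow> 'o \<Rightarrow> 'm set" where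
  "hom1 K A B = {f \<in> Arr K. src K f = A \<and> trg K f = B}"

definition hom2 :: "('o, 'm, 'c, 'x) twocat_scheme \<Rightarrow> 'm \<Rightarrow> 'm \<Rightarrow> 'c set" where
  "hom2 K f g = {\<alpha> \<in> Cell K. dom2 K \<alpha> = f \<and> cod2 K \<alpha> = g}"

text \<open>
  All compositions are written in applicative order: \<open>g \<odot> f\<close>, \<open>\<beta> \<bullet> \<alpha>\<close> and \<open>\<beta> \<star> \<alpha>\<close> apply the
  right-hand argument first.
\<close>

locale two_category =
  fixes K :: "('o, 'm, 'c, 'x) twocat_scheme" (structure)
  assumes src_trg: "f \<in> Arr K \<Longrightarrow> src K f \<in> Obj K \<and> trg K f \<in> Obj K"
    and idn_hom: "A \<in> Obj K \<Longrightarrow> idn K A \<in> hom1 K A A"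
    and comp_hom: "\<lbrakk>f \<in> hom1 K A B; g \<in> hom1 K B C\<rbrakk> \<Longrightarrow> g \<odot> f \<in> hom1 K A C"
    and comp_idn: "f \<in> hom1 K A B \<Longrightarrow> f \<odot> idn K A = f"
    and idn_comp: "f \<in> hom1 K A B \<Longrightarrow> idn K B \<odot> f = f"
    and comp_assoc: "\<lbrakk>f \<in> hom1 K A B; g \<in> hom1 K B C; h \<in> hom1 K C D\<rbrakk>
      \<Longrightarrow> (h \<odot> g) \<odot> f = h \<odot> (g \<odot> f)"
    and cell_boundary: "\<alpha> \<in> Cell K \<Longrightarrow> dom2 K \<alpha> \<in> Arr K \<and> cod2 K \<alpha> \<in> Arr K
      \<and> src K (dom2 K \<alpha>) = src K (cod2 K \<alpha>) \<and> trg K (dom2 K \<alpha>) = trg K (cod2 K \<alpha>)"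
    and id2_hom: "f \<in> Arr K \<Longrightarrow> id2 K f \<in> hom2 K f f"
    and vcomp_hom: "\<lbrakk>\<alpha> \<in> hom2 K f g; \<beta> \<in> hom2 K g h\<rbrakk> \<Longrightarrow> \<beta> \<bullet> \<alpha> \<in> hom2 K f h"
    and vcomp_id2: "\<alpha> \<in> hom2 K f g \<Longrightarrow> \<alpha> \<bullet> id2 K f = \<alpha>"
    and id2_vcomp: "\<alpha> \<in> hom2 K f g \<Longrightarrow> id2 K g \<bullet> \<alpha> = \<alpha>"
    and vcomp_assoc: "\<lbrakk>\<alpha> \<in> hom2 K f g; \<beta> \<in> hom2 K g h; \<gamma> \<in> hom2 K h k\<rbrakk>
      \<Longrightarrow> (\<gamma> \<bullet> \<beta>) \<bullet> \<alpha> = \<gamma> \<bullet> (\<beta> \<bullet> \<alpha>)"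
    and hcomp_hom: "\<lbrakk>f \<in> hom1 K A B; g \<in> hom1 K B C; \<alpha> \<in> hom2 K f f'; \<beta> \<in> hom2 K g g'\<rbrakk>
      \<Longrightarrow> \<beta> \<star> \<alpha> \<in> hom2 K (g \<odot> f) (g' \<odot> f')"
    and hcomp_idn: "\<lbrakk>f \<in> hom1 K A B; \<alpha> \<in> hom2 K f f'\<rbrakk> \<Longrightarrow> \<alpha> \<star> id2 K (idn K A) = \<alpha>"
    and idn_hcomp: "\<lbrakk>f \<in> hom1 K A B; \<alpha> \<in> hom2 K f f'\<rbrakk> \<Longrightarrow> id2 K (idn K B) \<star> \<alpha> = \<alpha>"
    and hcomp_assoc: "\<lbrakk>f \<in> hom1 K A B; g \<in> hom1 K B C; h \<in> hom1 K C D;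
        \<alpha> \<in> hom2 K f f'; \<beta> \<in> hom2 K g g'; \<gamma> \<in> hom2 K h h'\<rbrakk>
      \<Longrightarrow> (\<gamma> \<star> \<beta>) \<star> \<alpha> = \<gamma> \<star> (\<beta> \<star> \<alpha>)"
    and hcomp_id2: "\<lbrakk>f \<in> hom1 K A B; g \<in> hom1 K B C\<rbrakk> \<Longrightarrow> id2 K g \<star> id2 K f = id2 K (g \<odot> f)"
    and interchange: "\<lbrakk>f \<in> hom1 K A B; g \<in> hom1 K B C;
        \<alpha> \<in> hom2 K f f'; \<alpha>' \<in> hom2 K f' f''; \<beta> \<in> hom2 K g g'; \<beta>' \<in> hom2 K g' g''\<rbrakk>
      \<Longrightarrow> (\<beta>' \<bullet> \<beta>) \<star> (\<alpha>' \<bullet> \<alpha>) = (\<beta>' \<star> \<alpha>') \<bullet> (\<beta> \<star> \<alpha>)"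

definition invertible2 :: "('o, 'm, 'c, 'x) twocat_scheme \<Rightarrow> 'c \<Rightarrow> bool" where
  "invertible2 K \<alpha> \<longleftrightarrow> \<alpha> \<in> Cell K \<and>
     (\<exists>\<beta> \<in> hom2 K (cod2 K \<alpha>) (dom2 K \<alpha>).
        \<beta> \<bullet>\<^bsub>K\<^esub> \<alpha> = id2 K (dom2 K \<alpha>) \<and> \<alpha> \<bullet>\<^bsub>K\<^esub> \<beta> = id2 K (cod2 K \<alpha>))"

definition equivalent :: "('o, 'm, 'c, 'x) twocat_scheme \<Rightarrow> 'o \<Rightarrow> 'o \<Rightarrow> bool" where
  "equivalent K A B \<longleftrightarrow> A \<in> Obj K \<and> B \<in> Obj K \<and>
     (\<exists>f \<in> hom1 K A B. \<exists>g \<in> hom1 K B A.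
        (\<exists>\<alpha> \<in> hom2 K (idn K A) (g \<odot>\<^bsub>K\<^esub> f). invertible2 K \<alpha>) \<and>
        (\<exists>\<beta> \<in> hom2 K (f \<odot>\<^bsub>K\<^esub> g) (idn K B). invertible2 K \<beta>))"

text \<open>\<open>L \<stileturn> i\<close>, with unit \<open>\<eta>\<close>, counit \<open>\<epsilon>\<close> and the two triangle identities.\<close>

definition adjoint :: "('o, 'm, 'c, 'x) twocat_scheme \<Rightarrow> 'm \<Rightarrow> 'm \<Rightarrow> bool" where
  "adjoint K L i \<longleftrightarrow> L \<in> Arr K \<and> i \<in> Arr K \<and> src K L = trg K i \<and> trg K L = src K i \<and>
     (\<exists>\<eta> \<in> hom2 K (idn K (src K L)) (i \<odot>\<^bsub>K\<^esub> L).
      \<exists>\<epsilon> \<in> hom2 K (L \<odot>\<^bsub>K\<^esub> i) (idn K (src K i)).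
        (\<epsilon> \<star>\<^bsub>K\<^esub> id2 K L) \<bullet>\<^bsub>K\<^esub> (id2 K L \<star>\<^bsub>K\<^esub> \<eta>) = id2 K L \<and>
        (id2 K i \<star>\<^bsub>K\<^esub> \<epsilon>) \<bullet>\<^bsub>K\<^esub> (\<eta> \<star>\<^bsub>K\<^esub> id2 K i) = id2 K i)"

definition fully_faithful :: "('o, 'm, 'c, 'x) twocat_scheme \<Rightarrow> 'm \<Rightarrow> bool" where
  "fully_faithful K i \<longleftrightarrow> i \<in> Arr K \<and>
     (\<forall>X \<in> Obj K. \<forall>f \<in> hom1 K X (src K i). \<forall>g \<in> hom1 K X (src K i).
        bij_betw (\<lambda>\<alpha>. id2 K i \<star>\<^bsub>K\<^esub> \<alpha>) (hom2 K f g) (hom2 K (i \<odot>\<^bsub>K\<^esub> f) (i \<odot>\<^bsub>K\<^esub> g)))"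


section \<open>Left extensions\<close>

text \<open>\<open>\<eta> : f \<Rightarrow> l \<odot> j\<close> exhibits \<open>l\<close> as a left extension of \<open>f\<close> along \<open>j\<close>.\<close>

definition is_lan ::
    "('o, 'm, 'c, 'x) twocat_scheme \<Rightarrow> 'm \<Rightarrow> 'm \<Rightarrow> 'm \<Rightarrow> 'c \<Rightarrow> bool" where
  "is_lan K j f l \<eta> \<longleftrightarrow>
     j \<in> Arr K \<and> f \<in> hom1 K (src K j) (trg K f) \<and> l \<in> hom1 K (trg K j) (trg K f) \<and>
     \<eta> \<in> hom2 K f (l \<odot>\<^bsub>K\<^esub> j) \<and>
     (\<forall>g \<in> hom1 K (trg K j) (trg K f).
        bij_betw (\<lambda>\<beta>. (\<beta> \<star>\<^bsub>K\<^esub> id2 K j) \<bullet>\<^bsub>K\<^esub> \<eta>) (hom2 K l g) (hom2 K f (g \<odot>\<^bsub>K\<^esub> j)))"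

definition preserves_lan ::
    "('o, 'm, 'c, 'x) twocat_scheme \<Rightarrow> 'm \<Rightarrow> 'm \<Rightarrow> 'm \<Rightarrow> 'm \<Rightarrow> 'c \<Rightarrow> bool" where
  "preserves_lan K k j f l \<eta> \<longleftrightarrow>
     k \<in> Arr K \<and> src K k = trg K f \<and>
     is_lan K j (k \<odot>\<^bsub>K\<^esub> f) (k \<odot>\<^bsub>K\<^esub> l) (id2 K k \<star>\<^bsub>K\<^esub> \<eta>)"


section \<open>KZ doctrines\<close>

text \<open>
  For \<open>f : A \<rightarrow> S B\<close>, the chosen extension is \<open>ext S B f : S A \<rightarrow> S B\<close> with exhibiting 2-cell
  \<open>ext_cell S B f\<close>. The object \<open>B\<close> is an explicit argument because \<open>on_obj S\<close> need not be
  injective; \<open>A\<close> is the source of \<open>f\<close>.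
\<close>

record ('o, 'm, 'c) doctrine =
  on_obj   :: "'o \<Rightarrow> 'o"
  unit_of  :: "'o \<Rightarrow> 'm"
  ext      :: "'o \<Rightarrow> 'm \<Rightarrow> 'm"
  ext_cell :: "'o \<Rightarrow> 'm \<Rightarrow> 'c"

definition kz_doctrine ::
    "('o, 'm, 'c, 'x) twocat_scheme \<Rightarrow> ('o, 'm, 'c, 'y) doctrine_scheme \<Rightarrow> bool" where
  "kz_doctrine K S \<longleftrightarrow>
     (\<forall>A \<in> Obj K. on_obj S A \<in> Obj K \<and> unit_of S A \<in> hom1 K A (on_obj S A)) \<and>
     (\<forall>A \<in> Obj K. \<forall>B \<in> Obj K. \<forall>f \<in> hom1 K A (on_obj S B).
        is_lan K (unit_of S A) f (ext S B f) (ext_cell S B f) \<and>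
        invertible2 K (ext_cell S B f)) \<and>
     (\<forall>A \<in> Obj K. ext S A (unit_of S A) = idn K (on_obj S A) \<and>
        ext_cell S A (unit_of S A) = id2 K (unit_of S A)) \<and>
     (\<forall>A \<in> Obj K. \<forall>B \<in> Obj K. \<forall>C \<in> Obj K.
        \<forall>f \<in> hom1 K A (on_obj S B). \<forall>g \<in> hom1 K B (on_obj S C).
          preserves_lan K (ext S C g) (unit_of S A) f (ext S B f) (ext_cell S B f))"

definition push ::
    "('o, 'm, 'c, 'x) twocat_scheme \<Rightarrow> ('o, 'm, 'c, 'y) doctrine_scheme \<Rightarrow> 'm \<Rightarrow> 'm" where
  "push K S f = ext S (trg K f) (unit_of S (trg K f) \<odot>\<^bsub>K\<^esub> f)"

definition cocomplete ::
    "('o, 'm, 'c, 'x) twocat_scheme \<Rightarrow> ('o, 'm, 'c, 'y) doctrine_scheme \<Rightarrow> 'o \<Rightarrow> bool" where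
  "cocomplete K S X \<longleftrightarrow> X \<in> Obj K \<and>
     (\<forall>B \<in> Obj K. \<forall>g \<in> hom1 K B X. \<exists>l \<eta>.
        is_lan K (unit_of S B) g l \<eta> \<and> invertible2 K \<eta> \<and>
        (\<forall>A \<in> Obj K. \<forall>f \<in> hom1 K A (on_obj S B).
           preserves_lan K l (unit_of S A) f (ext S B f) (ext_cell S B f)))"

definition cocontinuous ::
    "('o, 'm, 'c, 'x) twocat_scheme \<Rightarrow> ('o, 'm, 'c, 'y) doctrine_scheme \<Rightarrow> 'm \<Rightarrow> bool" where
  "cocontinuous K S E \<longleftrightarrow> E \<in> Arr K \<and> cocomplete K S (src K E) \<and> cocomplete K S (trg K E) \<and>
     (\<forall>B \<in> Obj K. \<forall>f \<in> hom1 K B (src K E). \<forall>l \<eta>.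
        is_lan K (unit_of S B) f l \<eta> \<longrightarrow> preserves_lan K E (unit_of S B) f l \<eta>)"

text \<open>
  Left extensions are unique up to unique invertible 2-cell, so ``the'' extension of \<open>h\<close> along the
  unit, which is not part of the data of a cocomplete object, is rendered by quantifying over
  all of them.
\<close>

definition admissible ::
    "('o, 'm, 'c, 'x) twocat_scheme \<Rightarrow> ('o, 'm, 'c, 'y) doctrine_scheme \<Rightarrow> 'm \<Rightarrow> bool" where
  "admissible K S f \<longleftrightarrow> f \<in> Arr K \<and>
     (\<exists>n \<chi>. is_lan K f (unit_of S (src K f)) n \<chi> \<and>
        (\<forall>X h l \<eta>. cocomplete K S X \<and> h \<in> hom1 K (src K f) X \<and>
           is_lan K (unit_of S (src K f)) h l \<eta> \<longrightarrow>
             preserves_lan K l f (unit_of S (src K f)) n \<chi>))"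

definition petit ::
    "('o, 'm, 'c, 'x) twocat_scheme \<Rightarrow> ('o, 'm, 'c, 'y) doctrine_scheme \<Rightarrow> 'o \<Rightarrow> bool" where
  "petit K S A \<longleftrightarrow> A \<in> Obj K \<and> (\<forall>B \<in> Obj K. \<forall>f \<in> hom1 K A B. admissible K S f)"


section \<open>KZ contexts\<close>

definition kz_context ::
    "('o, 'm, 'c, 'x) twocat_scheme \<Rightarrow> ('o, 'm, 'c, 'y) doctrine_scheme \<Rightarrow>
     ('o, 'm, 'c, 'z) doctrine_scheme \<Rightarrow> ('o \<Rightarrow> 'm) \<Rightarrow> bool" where
  "kz_context K P S \<upsilon> \<longleftrightarrow>
     kz_doctrine K P \<and> kz_doctrine K S \<and>
     (\<forall>A \<in> Obj K. fully_faithful K (unit_of P A) \<and> fully_faithful K (unit_of S A)) \<and>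
     (\<forall>A \<in> Obj K. cocomplete K S (on_obj P A)) \<and>
     (\<forall>A \<in> Obj K. \<forall>B \<in> Obj K. \<forall>f \<in> hom1 K A B. cocontinuous K S (push K P f)) \<and>
     (\<forall>A \<in> Obj K. (\<exists>\<eta>. is_lan K (unit_of S A) (unit_of P A) (\<upsilon> A) \<eta>) \<and>
        fully_faithful K (\<upsilon> A))"

definition accessible ::
    "('o, 'm, 'c, 'x) twocat_scheme \<Rightarrow> ('o, 'm, 'c, 'y) doctrine_scheme \<Rightarrow>
     ('o, 'm, 'c, 'z) doctrine_scheme \<Rightarrow> 'o \<Rightarrow> bool" where
  "accessible K P S A \<longleftrightarrow> (\<exists>G. petit K P G \<and> equivalent K A (on_obj S G))"

definition presentable ::
    "('o, 'm, 'c, 'x) twocat_scheme \<Rightarrow> ('o, 'm, 'c, 'y) doctrine_scheme \<Rightarrow>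
     ('o, 'm, 'c, 'z) doctrine_scheme \<Rightarrow> 'o \<Rightarrow> bool" where
  "presentable K P S A \<longleftrightarrow> accessible K P S A \<and>
     (\<exists>G L i. petit K P G \<and> L \<in> hom1 K (on_obj P G) A \<and> i \<in> hom1 K A (on_obj P G) \<and>
        adjoint K L i \<and> fully_faithful K i \<and> cocontinuous K S i)"

end

theory Submission
  imports Defs
begin

text \<open>
  The theorem is a 2-categorical form of the fact that an accessible category is cocomplete
  precisely when it is a suitable reflective subcategory of presheaves. Two ideas carry it.

  \<^emph>\<open>Cocompleteness passes to reflective objects.\<close> Let \<open>L \<stileturn> i\<close> with \<open>i : A \<rightarrow> X\<close> fully faithful, so
  that the counit is invertible. The extension of \<open>g : B \<rightarrow> A\<close> is obtained by extending \<open>i \<odot> g\<close>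
  into \<open>X\<close> and reflecting it back by \<open>L\<close>; since left adjoints preserve left extensions, nothing
  is lost (\<open>cocomplete_reflective\<close>). With \<open>X = P G\<close> and the doctrine \<open>P\<close> this says that
  presentable objects are \<open>P\<close>-cocomplete.

  \<^emph>\<open>Realization is left adjoint to the nerve.\<close> Let \<open>A\<close> be \<open>P\<close>-cocomplete, with mutually adjoint
  equivalences \<open>e : A \<rightarrow> S G\<close> and \<open>r : S G \<rightarrow> A\<close>, and let \<open>G\<close> be \<open>P\<close>-petit. Put \<open>h = r \<odot> \<sigma>\<close>,
  with \<open>\<sigma> : G \<rightarrow> S G\<close> and \<open>y : G \<rightarrow> P G\<close> the units. Then \<open>i = \<upsilon> G \<odot> e\<close> is a left
  extension of \<open>y\<close> along \<open>h\<close>, because extending along the left adjoint \<open>r\<close> is precomposing with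
  its right adjoint \<open>e\<close>. The realization \<open>H : P G \<rightarrow> A\<close>, the extension of \<open>h\<close> along \<open>y\<close>,
  preserves the extension \<open>i\<close> because \<open>h\<close> is admissible, and this yields \<open>H \<stileturn> i\<close>
  (\<open>realization_adjoint_nerve\<close>). The 1-cell \<open>i\<close> is fully faithful as a composite of two such
  1-cells. It is \<open>S\<close>-cocontinuous because \<open>e\<close> is a left adjoint and \<open>\<upsilon> G\<close> is itself an
  extension along \<open>\<sigma>\<close> into the \<open>S\<close>-cocomplete object \<open>P G\<close>; that \<open>A\<close> is \<open>S\<close>-cocomplete
  follows from the first idea, now applied to \<open>H \<stileturn> i\<close> and the doctrine \<open>S\<close>.
\<close>

section \<open>Calculus of pasting in a strict 2-category\<close>

text \<open>
  Unlike \<open>invertible2\<close> and \<open>adjoint\<close>, the next two predicates name their witnesses, which the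
  pasting calculations below have to mention.
\<close>

definition inverse_cells ::
    "('o, 'm, 'c, 'x) twocat_scheme \<Rightarrow> 'm \<Rightarrow> 'm \<Rightarrow> 'c \<Rightarrow> 'c \<Rightarrow> bool" where
  "inverse_cells K f g \<alpha> \<beta> \<longleftrightarrow> \<alpha> \<in> hom2 K f g \<and> \<beta> \<in> hom2 K g f \<and>
     \<beta> \<bullet>\<^bsub>K\<^esub> \<alpha> = id2 K f \<and> \<alpha> \<bullet>\<^bsub>K\<^esub> \<beta> = id2 K g"

definition adjunction ::
    "('o, 'm, 'c, 'x) twocat_scheme \<Rightarrow> 'm \<Rightarrow> 'm \<Rightarrow> 'c \<Rightarrow> 'c \<Rightarrow> bool" where
  "adjunction K L i \<eta> \<epsilon> \<longleftrightarrow> L \<in> Arr K \<and> i \<in> Arr K \<and> src K L = trg K i \<and> trg K L = src K i \<and>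
     \<eta> \<in> hom2 K (idn K (src K L)) (i \<odot>\<^bsub>K\<^esub> L) \<and> \<epsilon> \<in> hom2 K (L \<odot>\<^bsub>K\<^esub> i) (idn K (src K i)) \<and>
     (\<epsilon> \<star>\<^bsub>K\<^esub> id2 K L) \<bullet>\<^bsub>K\<^esub> (id2 K L \<star>\<^bsub>K\<^esub> \<eta>) = id2 K L \<and>
     (id2 K i \<star>\<^bsub>K\<^esub> \<epsilon>) \<bullet>\<^bsub>K\<^esub> (\<eta> \<star>\<^bsub>K\<^esub> id2 K i) = id2 K i"

lemma adjoint_iff_adjunction: "adjoint K L i \<longleftrightarrow> (\<exists>\<eta> \<epsilon>. adjunction K L i \<eta> \<epsilon>)"
  unfolding adjoint_def adjunction_def by blast

lemma inverse_cells_sym: "inverse_cells K f g \<alpha> \<beta> \<Longrightarrow> inverse_cells K g f \<beta> \<alpha>"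
  unfolding inverse_cells_def by blast

lemma invertible2_iff_inverse_cells:
  "\<alpha> \<in> hom2 K f g \<Longrightarrow> invertible2 K \<alpha> \<longleftrightarrow> (\<exists>\<beta>. inverse_cells K f g \<alpha> \<beta>)"
  unfolding invertible2_def inverse_cells_def hom2_def by auto

lemma inverse_cells_invertible2: "inverse_cells K f g \<alpha> \<beta> \<Longrightarrow> invertible2 K \<alpha>"
  unfolding invertible2_def inverse_cells_def hom2_def by auto

context two_category
begin

lemma idn_simps:
  "A \<in> Obj K \<Longrightarrow> idn K A \<in> Arr K"
  "A \<in> Obj K \<Longrightarrow> src K (idn K A) = A"
  "A \<in> Obj K \<Longrightarrow> trg K (idn K A) = A"
  using idn_hom unfolding hom1_def by auto

lemma boundary_Obj:
  "f \<in> Arr K \<Longrightarrow> src K f \<in> Obj K"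
  "f \<in> Arr K \<Longrightarrow> trg K f \<in> Obj K"
  using src_trg by auto

lemma hom1_Obj: "f \<in> hom1 K A B \<Longrightarrow> A \<in> Obj K" "f \<in> hom1 K A B \<Longrightarrow> B \<in> Obj K"
  using src_trg unfolding hom1_def by auto

lemma comp_simps:
  assumes "f \<in> Arr K" "g \<in> Arr K" "src K g = trg K f"
  shows "g \<odot> f \<in> Arr K" "src K (g \<odot> f) = src K f" "trg K (g \<odot> f) = trg K g"
  using comp_hom[of f "src K f" "trg K f" g "trg K g"] assms unfolding hom1_def by auto

lemma comp_unit_simps:
  "f \<in> Arr K \<Longrightarrow> src K f = A \<Longrightarrow> f \<odot> idn K A = f"
  "f \<in> Arr K \<Longrightarrow> trg K f = A \<Longrightarrow> idn K A \<odot> f = f"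
  using comp_idn[of f "src K f" "trg K f"] idn_comp[of f "src K f" "trg K f"]
  unfolding hom1_def by auto

lemma comp_assoc_simp:
  assumes "f \<in> Arr K" "g \<in> Arr K" "h \<in> Arr K" "src K g = trg K f" "src K h = trg K g"
  shows "(h \<odot> g) \<odot> f = h \<odot> (g \<odot> f)"
  using comp_assoc[of f "src K f" "trg K f" g "trg K g" h "trg K h"] assms
  unfolding hom1_def by auto

lemma cell_boundary_simps:
  "\<alpha> \<in> Cell K \<Longrightarrow> dom2 K \<alpha> \<in> Arr K"
  "\<alpha> \<in> Cell K \<Longrightarrow> cod2 K \<alpha> \<in> Arr K"
  "\<alpha> \<in> Cell K \<Longrightarrow> src K (cod2 K \<alpha>) = src K (dom2 K \<alpha>)"
  "\<alpha> \<in> Cell K \<Longrightarrow> trg K (cod2 K \<alpha>) = trg K (dom2 K \<alpha>)"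
  using cell_boundary by auto

lemma id2_simps:
  "f \<in> Arr K \<Longrightarrow> id2 K f \<in> Cell K"
  "f \<in> Arr K \<Longrightarrow> dom2 K (id2 K f) = f"
  "f \<in> Arr K \<Longrightarrow> cod2 K (id2 K f) = f"
  using id2_hom unfolding hom2_def by auto

lemma vcomp_simps:
  assumes "\<alpha> \<in> Cell K" "\<beta> \<in> Cell K" "cod2 K \<alpha> = dom2 K \<beta>"
  shows "\<beta> \<bullet> \<alpha> \<in> Cell K" "dom2 K (\<beta> \<bullet> \<alpha>) = dom2 K \<alpha>" "cod2 K (\<beta> \<bullet> \<alpha>) = cod2 K \<beta>"
  using vcomp_hom[of \<alpha> "dom2 K \<alpha>" "cod2 K \<alpha>" \<beta> "cod2 K \<beta>"] assms
  unfolding hom2_def by auto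

lemma vcomp_unit_simps:
  "\<alpha> \<in> Cell K \<Longrightarrow> dom2 K \<alpha> = f \<Longrightarrow> \<alpha> \<bullet> id2 K f = \<alpha>"
  "\<alpha> \<in> Cell K \<Longrightarrow> cod2 K \<alpha> = f \<Longrightarrow> id2 K f \<bullet> \<alpha> = \<alpha>"
  using vcomp_id2[of \<alpha> "dom2 K \<alpha>" "cod2 K \<alpha>"] id2_vcomp[of \<alpha> "dom2 K \<alpha>" "cod2 K \<alpha>"]
  unfolding hom2_def by auto

lemma vcomp_assoc_simp:
  assumes "\<alpha> \<in> Cell K" "\<beta> \<in> Cell K" "\<gamma> \<in> Cell K" "cod2 K \<alpha> = dom2 K \<beta>" "cod2 K \<beta> = dom2 K \<gamma>"
  shows "(\<gamma> \<bullet> \<beta>) \<bullet> \<alpha> = \<gamma> \<bullet> (\<beta> \<bullet> \<alpha>)"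
  using vcomp_assoc[of \<alpha> "dom2 K \<alpha>" "cod2 K \<alpha>" \<beta> "cod2 K \<beta>" \<gamma> "cod2 K \<gamma>"] assms
  unfolding hom2_def by auto

lemma hcomp_simps:
  assumes "\<alpha> \<in> Cell K" "\<beta> \<in> Cell K" "src K (dom2 K \<beta>) = trg K (dom2 K \<alpha>)"
  shows "\<beta> \<star> \<alpha> \<in> Cell K" "dom2 K (\<beta> \<star> \<alpha>) = dom2 K \<beta> \<odot> dom2 K \<alpha>"
    "cod2 K (\<beta> \<star> \<alpha>) = cod2 K \<beta> \<odot> cod2 K \<alpha>"
  using hcomp_hom[of "dom2 K \<alpha>" "src K (dom2 K \<alpha>)" "trg K (dom2 K \<alpha>)" "dom2 K \<beta>"
      "trg K (dom2 K \<beta>)" \<alpha> "cod2 K \<alpha>" \<beta> "cod2 K \<beta>"] assms cell_boundary_simps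
  unfolding hom2_def hom1_def by auto

lemma hcomp_unit_simps:
  "\<alpha> \<in> Cell K \<Longrightarrow> src K (dom2 K \<alpha>) = A \<Longrightarrow> \<alpha> \<star> id2 K (idn K A) = \<alpha>"
  "\<alpha> \<in> Cell K \<Longrightarrow> trg K (dom2 K \<alpha>) = A \<Longrightarrow> id2 K (idn K A) \<star> \<alpha> = \<alpha>"
  using hcomp_idn[of "dom2 K \<alpha>" "src K (dom2 K \<alpha>)" "trg K (dom2 K \<alpha>)" \<alpha> "cod2 K \<alpha>"]
    idn_hcomp[of "dom2 K \<alpha>" "src K (dom2 K \<alpha>)" "trg K (dom2 K \<alpha>)" \<alpha> "cod2 K \<alpha>"]
    cell_boundary_simps
  unfolding hom2_def hom1_def by auto

lemma hcomp_assoc_simp: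
  assumes "\<alpha> \<in> Cell K" "\<beta> \<in> Cell K" "\<gamma> \<in> Cell K"
    "src K (dom2 K \<beta>) = trg K (dom2 K \<alpha>)" "src K (dom2 K \<gamma>) = trg K (dom2 K \<beta>)"
  shows "(\<gamma> \<star> \<beta>) \<star> \<alpha> = \<gamma> \<star> (\<beta> \<star> \<alpha>)"
  using hcomp_assoc[of "dom2 K \<alpha>" "src K (dom2 K \<alpha>)" "trg K (dom2 K \<alpha>)" "dom2 K \<beta>"
      "trg K (dom2 K \<beta>)" "dom2 K \<gamma>" "trg K (dom2 K \<gamma>)" \<alpha> "cod2 K \<alpha>" \<beta> "cod2 K \<beta>" \<gamma> "cod2 K \<gamma>"]
    assms cell_boundary_simps
  unfolding hom2_def hom1_def by auto

lemma hcomp_id2_simp: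
  "f \<in> Arr K \<Longrightarrow> g \<in> Arr K \<Longrightarrow> src K g = trg K f \<Longrightarrow> id2 K g \<star> id2 K f = id2 K (g \<odot> f)"
  using hcomp_id2[of f "src K f" "trg K f" g "trg K g"] unfolding hom1_def by auto

lemma whisker_whisker_left:
  assumes "\<alpha> \<in> Cell K" "f \<in> Arr K" "g \<in> Arr K" "src K f = trg K (dom2 K \<alpha>)" "src K g = trg K f"
  shows "id2 K g \<star> (id2 K f \<star> \<alpha>) = id2 K (g \<odot> f) \<star> \<alpha>"
  using hcomp_assoc_simp[of \<alpha> "id2 K f" "id2 K g"] assms by (simp add: id2_simps hcomp_id2_simp)

lemma interchange_cells:
  assumes "\<alpha> \<in> Cell K" "\<alpha>' \<in> Cell K" "\<beta> \<in> Cell K" "\<beta>' \<in> Cell K"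
    "cod2 K \<alpha> = dom2 K \<alpha>'" "cod2 K \<beta> = dom2 K \<beta>'" "src K (dom2 K \<beta>) = trg K (dom2 K \<alpha>)"
  shows "(\<beta>' \<star> \<alpha>') \<bullet> (\<beta> \<star> \<alpha>) = (\<beta>' \<bullet> \<beta>) \<star> (\<alpha>' \<bullet> \<alpha>)"
  using interchange[of "dom2 K \<alpha>" "src K (dom2 K \<alpha>)" "trg K (dom2 K \<alpha>)" "dom2 K \<beta>"
      "trg K (dom2 K \<beta>)" \<alpha> "cod2 K \<alpha>" \<alpha>' "cod2 K \<alpha>'" \<beta> "cod2 K \<beta>" \<beta>' "cod2 K \<beta>'"]
    assms cell_boundary_simps
  unfolding hom2_def hom1_def by auto

lemma whisker_left_vcomp:
  assumes "\<alpha> \<in> Cell K" "\<beta> \<in> Cell K" "cod2 K \<alpha> = dom2 K \<beta>"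
    "g \<in> Arr K" "src K g = trg K (dom2 K \<alpha>)"
  shows "id2 K g \<star> (\<beta> \<bullet> \<alpha>) = (id2 K g \<star> \<beta>) \<bullet> (id2 K g \<star> \<alpha>)"
  using interchange_cells[of \<alpha> \<beta> "id2 K g" "id2 K g"] assms
  by (simp add: id2_simps vcomp_unit_simps)

lemma whisker_right_vcomp:
  assumes "\<alpha> \<in> Cell K" "\<beta> \<in> Cell K" "cod2 K \<alpha> = dom2 K \<beta>"
    "f \<in> Arr K" "trg K f = src K (dom2 K \<alpha>)"
  shows "(\<beta> \<bullet> \<alpha>) \<star> id2 K f = (\<beta> \<star> id2 K f) \<bullet> (\<alpha> \<star> id2 K f)"
  using interchange_cells[of "id2 K f" "id2 K f" \<alpha> \<beta>] assms
  by (simp add: id2_simps vcomp_unit_simps)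

text \<open>
  Stated with boundary functions instead of hom-sets, the axioms become conditional rewrite rules
  whose premises the simplifier can discharge without guessing. They bring a pasting of whiskered
  cells into the form of a right-nested vertical composite of cells \<open>g \<star> (\<alpha> \<star> f)\<close>; what remains
  of the 2-category axioms is the order of two cells with disjoint support, handled by
  \<open>whisker_exchange\<close>.
\<close>

lemmas cell_simps = idn_simps boundary_Obj comp_simps comp_unit_simps comp_assoc_simp
  cell_boundary_simps id2_simps vcomp_simps vcomp_unit_simps vcomp_assoc_simp hcomp_simps
  hcomp_unit_simps hcomp_assoc_simp hcomp_id2_simp whisker_whisker_left whisker_left_vcomp
  whisker_right_vcomp

lemma whisker_exchange:
  assumes "\<alpha> \<in> hom2 K f f'" "\<beta> \<in> hom2 K g g'" "src K g = trg K f"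
  shows "(\<beta> \<star> id2 K f') \<bullet> (id2 K g \<star> \<alpha>) = (id2 K g' \<star> \<alpha>) \<bullet> (\<beta> \<star> id2 K f)"
proof -
  have t: "\<alpha> \<in> Cell K" "dom2 K \<alpha> = f" "cod2 K \<alpha> = f'" "\<beta> \<in> Cell K" "dom2 K \<beta> = g" "cod2 K \<beta> = g'"
    using assms unfolding hom2_def by auto
  have a: "f \<in> Arr K" "f' \<in> Arr K" "g \<in> Arr K" "g' \<in> Arr K"
      "trg K f' = trg K f" "src K g' = src K g"
    using cell_boundary[of \<alpha>] cell_boundary[of \<beta>] t by auto
  have "(\<beta> \<star> id2 K f') \<bullet> (id2 K g \<star> \<alpha>) = \<beta> \<star> \<alpha>"
    using interchange_cells[of \<alpha> "id2 K f'" "id2 K g" \<beta>] t a assms(3)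
    by (simp add: id2_simps vcomp_unit_simps)
  moreover have "(id2 K g' \<star> \<alpha>) \<bullet> (\<beta> \<star> id2 K f) = \<beta> \<star> \<alpha>"
    using interchange_cells[of "id2 K f" \<alpha> \<beta> "id2 K g'"] t a assms(3)
    by (simp add: id2_simps vcomp_unit_simps)
  ultimately show ?thesis by simp
qed

lemma inverse_cells_vcomp:
  assumes "inverse_cells K f g \<alpha> \<alpha>'" "inverse_cells K g h \<beta> \<beta>'"
  shows "inverse_cells K f h (\<beta> \<bullet> \<alpha>) (\<alpha>' \<bullet> \<beta>')"
proof -
  note t = assms[unfolded inverse_cells_def hom2_def, simplified]
  have a: "\<beta>' \<bullet> (\<beta> \<bullet> \<alpha>) = \<alpha>"
    using t vcomp_assoc_simp[of \<alpha> \<beta> \<beta>'] by (simp add: vcomp_unit_simps)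
  have b: "\<alpha> \<bullet> (\<alpha>' \<bullet> \<beta>') = \<beta>'"
    using t vcomp_assoc_simp[of \<beta>' \<alpha>' \<alpha>] by (simp add: vcomp_unit_simps)
  have 1: "(\<alpha>' \<bullet> \<beta>') \<bullet> (\<beta> \<bullet> \<alpha>) = id2 K f"
    using t a by (simp add: vcomp_assoc_simp vcomp_simps)
  have 2: "(\<beta> \<bullet> \<alpha>) \<bullet> (\<alpha>' \<bullet> \<beta>') = id2 K h"
    using t b by (simp add: vcomp_assoc_simp vcomp_simps)
  show ?thesis using t 1 2 unfolding inverse_cells_def hom2_def by (simp add: vcomp_simps)
qed

lemma inverse_cells_id2: "f \<in> Arr K \<Longrightarrow> inverse_cells K f f (id2 K f) (id2 K f)"
  unfolding inverse_cells_def hom2_def by (simp add: id2_simps vcomp_unit_simps)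

lemma inverse_cells_Arr:
  assumes "inverse_cells K f g \<alpha> \<beta>"
  shows "f \<in> Arr K" "g \<in> Arr K" "src K g = src K f" "trg K g = trg K f"
  using assms cell_boundary[of \<alpha>] unfolding inverse_cells_def hom2_def by auto

lemma inverse_cells_whisker_left:
  assumes "inverse_cells K f g \<alpha> \<beta>" "k \<in> Arr K" "src K k = trg K f"
  shows "inverse_cells K (k \<odot> f) (k \<odot> g) (id2 K k \<star> \<alpha>) (id2 K k \<star> \<beta>)"
proof -
  note t = assms(1)[unfolded inverse_cells_def hom2_def, simplified] assms(2,3)
    inverse_cells_Arr[OF assms(1)]
  have "(id2 K k \<star> \<beta>) \<bullet> (id2 K k \<star> \<alpha>) = id2 K k \<star> (\<beta> \<bullet> \<alpha>)"
       "(id2 K k \<star> \<alpha>) \<bullet> (id2 K k \<star> \<beta>) = id2 K k \<star> (\<alpha> \<bullet> \<beta>)"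
    by (subst whisker_left_vcomp; simp add: t)+
  then show ?thesis using t unfolding inverse_cells_def hom2_def by (simp add: cell_simps)
qed

lemma inverse_cells_whisker_right:
  assumes "inverse_cells K f g \<alpha> \<beta>" "k \<in> Arr K" "trg K k = src K f"
  shows "inverse_cells K (f \<odot> k) (g \<odot> k) (\<alpha> \<star> id2 K k) (\<beta> \<star> id2 K k)"
proof -
  note t = assms(1)[unfolded inverse_cells_def hom2_def, simplified] assms(2,3)
    inverse_cells_Arr[OF assms(1)]
  have "(\<beta> \<star> id2 K k) \<bullet> (\<alpha> \<star> id2 K k) = (\<beta> \<bullet> \<alpha>) \<star> id2 K k"
       "(\<alpha> \<star> id2 K k) \<bullet> (\<beta> \<star> id2 K k) = (\<alpha> \<bullet> \<beta>) \<star> id2 K k"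
    by (subst whisker_right_vcomp; simp add: t)+
  then show ?thesis using t unfolding inverse_cells_def hom2_def by (simp add: cell_simps)
qed

lemma inverse_cells_precomp_bij:
  assumes "inverse_cells K f' f \<phi> \<phi>'"
  shows "bij_betw (\<lambda>\<psi>. \<psi> \<bullet> \<phi>) (hom2 K f g) (hom2 K f' g)"
proof -
  note t = assms[unfolded inverse_cells_def hom2_def, simplified]
  show ?thesis
  proof (rule bij_betw_byWitness[where f' = "\<lambda>\<psi>. \<psi> \<bullet> \<phi>'"])
    show "\<forall>\<psi>\<in>hom2 K f g. (\<psi> \<bullet> \<phi>) \<bullet> \<phi>' = \<psi>" "\<forall>\<psi>\<in>hom2 K f' g. (\<psi> \<bullet> \<phi>') \<bullet> \<phi> = \<psi>"
      using t by (auto simp: hom2_def vcomp_assoc_simp vcomp_unit_simps)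
  qed (use t in \<open>auto simp: hom2_def vcomp_simps\<close>)
qed


section \<open>Fully faithful 1-cells and equivalences\<close>

lemma fully_faithful_cancel:
  assumes "fully_faithful K i" "f \<in> hom1 K X (src K i)" "g \<in> hom1 K X (src K i)"
    "\<alpha> \<in> hom2 K f g" "\<beta> \<in> hom2 K f g" "id2 K i \<star> \<alpha> = id2 K i \<star> \<beta>"
  shows "\<alpha> = \<beta>"
  using assms hom1_Obj[OF assms(2)] unfolding fully_faithful_def bij_betw_def inj_on_def by blast

lemma fully_faithful_lift:
  assumes "fully_faithful K i" "f \<in> hom1 K X (src K i)" "g \<in> hom1 K X (src K i)"
    "\<gamma> \<in> hom2 K (i \<odot> f) (i \<odot> g)"
  obtains \<alpha> where "\<alpha> \<in> hom2 K f g" "id2 K i \<star> \<alpha> = \<gamma>"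
proof -
  have "bij_betw (\<lambda>\<alpha>. id2 K i \<star> \<alpha>) (hom2 K f g) (hom2 K (i \<odot> f) (i \<odot> g))"
    using assms hom1_Obj[OF assms(2)] unfolding fully_faithful_def by blast
  then have "\<gamma> \<in> (\<lambda>\<alpha>. id2 K i \<star> \<alpha>) ` hom2 K f g"
    using assms(4) unfolding bij_betw_def by simp
  then show ?thesis using that by blast
qed

lemma fully_faithful_comp:
  assumes i: "fully_faithful K i" and k: "fully_faithful K k" and ki: "src K k = trg K i"
  shows "fully_faithful K (k \<odot> i)"
proof -
  have a: "i \<in> Arr K" "k \<in> Arr K" using i k unfolding fully_faithful_def by auto
  { fix X f g assume X: "X \<in> Obj K" and f: "f \<in> hom1 K X (src K i)" and g: "g \<in> hom1 K X (src K i)"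
    note t = a ki f[unfolded hom1_def, simplified] g[unfolded hom1_def, simplified]
    have "bij_betw (\<lambda>\<alpha>. id2 K i \<star> \<alpha>) (hom2 K f g) (hom2 K (i \<odot> f) (i \<odot> g))"
      using i X f g unfolding fully_faithful_def by blast
    moreover have "bij_betw (\<lambda>\<alpha>. id2 K k \<star> \<alpha>) (hom2 K (i \<odot> f) (i \<odot> g))
        (hom2 K (k \<odot> (i \<odot> f)) (k \<odot> (i \<odot> g)))"
    proof -
      have "i \<odot> f \<in> hom1 K X (src K k)" "i \<odot> g \<in> hom1 K X (src K k)"
        using t by (auto simp: hom1_def comp_simps)
      then show ?thesis using k X unfolding fully_faithful_def by blast
    qed
    ultimately have "bij_betw ((\<lambda>\<alpha>. id2 K k \<star> \<alpha>) \<circ> (\<lambda>\<alpha>. id2 K i \<star> \<alpha>)) (hom2 K f g)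
        (hom2 K (k \<odot> (i \<odot> f)) (k \<odot> (i \<odot> g)))"
      by (rule bij_betw_trans)
    moreover have "((\<lambda>\<alpha>. id2 K k \<star> \<alpha>) \<circ> (\<lambda>\<alpha>. id2 K i \<star> \<alpha>)) \<alpha> = id2 K (k \<odot> i) \<star> \<alpha>"
      if "\<alpha> \<in> hom2 K f g" for \<alpha>
      using that t by (simp add: hom2_def cell_simps)
    ultimately have "bij_betw (\<lambda>\<alpha>. id2 K (k \<odot> i) \<star> \<alpha>) (hom2 K f g)
        (hom2 K (k \<odot> (i \<odot> f)) (k \<odot> (i \<odot> g)))"
      using bij_betw_cong by blast
    moreover have "(k \<odot> i) \<odot> f = k \<odot> (i \<odot> f)" "(k \<odot> i) \<odot> g = k \<odot> (i \<odot> g)"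
      using t by (auto simp: comp_assoc_simp)
    ultimately have "bij_betw (\<lambda>\<alpha>. id2 K (k \<odot> i) \<star> \<alpha>) (hom2 K f g)
        (hom2 K ((k \<odot> i) \<odot> f) ((k \<odot> i) \<odot> g))"
      by simp }
  then show ?thesis using a ki unfolding fully_faithful_def by (simp add: comp_simps)
qed

text \<open>
  An inverse for \<open>e\<close> on one side is enough for faithfulness, so the lemma applies to both halves
  of an equivalence.
\<close>

lemma faithful_if_left_inverse_up_to_iso:
  assumes e: "e \<in> hom1 K A B" and r: "r \<in> hom1 K B A"
    and \<alpha>: "inverse_cells K (idn K A) (r \<odot> e) \<alpha> \<alpha>'"
    and f: "f \<in> hom1 K X A" and g: "g \<in> hom1 K X A"
    and \<gamma>: "\<gamma> \<in> hom2 K f g" and \<delta>: "\<delta> \<in> hom2 K f g"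
    and eq: "id2 K e \<star> \<gamma> = id2 K e \<star> \<delta>"
  shows "\<gamma> = \<delta>"
proof -
  note A = hom1_Obj(1)[OF e]
  note t = e[unfolded hom1_def, simplified] r[unfolded hom1_def, simplified] A
    f[unfolded hom1_def, simplified] g[unfolded hom1_def, simplified]
    \<alpha>[unfolded inverse_cells_def hom2_def, simplified]
  \<comment> \<open>Conjugation by \<open>\<alpha>\<close> recovers a cell from its image under \<open>r \<odot> e\<close>.\<close>
  have key: "(\<alpha>' \<star> id2 K g) \<bullet> (id2 K r \<star> (id2 K e \<star> \<xi>)) \<bullet> (\<alpha> \<star> id2 K f) = \<xi>"
    if \<xi>: "\<xi> \<in> hom2 K f g" for \<xi>
  proof -
    note t' = t \<xi>[unfolded hom2_def, simplified]
    have inv: "(\<alpha>' \<star> id2 K g) \<bullet> (\<alpha> \<star> id2 K g) = id2 K g"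
      using inverse_cells_whisker_right[OF \<alpha>, of g] t'
      unfolding inverse_cells_def by (simp add: cell_simps)
    have ex: "(\<alpha> \<star> id2 K g) \<bullet> \<xi> = (id2 K (r \<odot> e) \<star> \<xi>) \<bullet> (\<alpha> \<star> id2 K f)"
      using whisker_exchange[OF \<xi>, of \<alpha> "idn K A" "r \<odot> e"] t' by (simp add: hom2_def cell_simps)
    have "(\<alpha>' \<star> id2 K g) \<bullet> (id2 K r \<star> (id2 K e \<star> \<xi>)) \<bullet> (\<alpha> \<star> id2 K f)
        = (\<alpha>' \<star> id2 K g) \<bullet> ((id2 K (r \<odot> e) \<star> \<xi>) \<bullet> (\<alpha> \<star> id2 K f))"
      using t' by (simp add: cell_simps)
    also have "\<dots> = ((\<alpha>' \<star> id2 K g) \<bullet> (\<alpha> \<star> id2 K g)) \<bullet> \<xi>"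
      unfolding ex[symmetric] using t' by (simp add: cell_simps)
    also have "\<dots> = \<xi>" unfolding inv using t' by (simp add: cell_simps)
    finally show ?thesis .
  qed
  show ?thesis using key[OF \<gamma>, unfolded eq] key[OF \<delta>] by (rule trans[OF sym])
qed

text \<open>
  To lift \<open>\<delta> : e \<odot> f \<Rightarrow> e \<odot> g\<close>, conjugate \<open>r \<star> \<delta>\<close> by \<open>\<alpha>\<close>. The result is only seen to lie over
  \<open>\<delta>\<close> after applying \<open>r\<close>, so faithfulness of \<open>r\<close> finishes the argument.
\<close>

lemma equivalence_fully_faithful:
  assumes e: "e \<in> hom1 K A B" and r: "r \<in> hom1 K B A"
    and \<alpha>: "inverse_cells K (idn K A) (r \<odot> e) \<alpha> \<alpha>'"
    and \<beta>: "inverse_cells K (e \<odot> r) (idn K B) \<beta> \<beta>'"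
  shows "fully_faithful K e"
proof -
  note A = hom1_Obj[OF e]
  { fix X f g assume X: "X \<in> Obj K" and f: "f \<in> hom1 K X A" and g: "g \<in> hom1 K X A"
    note t = e[unfolded hom1_def, simplified] r[unfolded hom1_def, simplified] A
      f[unfolded hom1_def, simplified] g[unfolded hom1_def, simplified]
      \<alpha>[unfolded inverse_cells_def hom2_def, simplified]
    have inj: "inj_on (\<lambda>\<gamma>. id2 K e \<star> \<gamma>) (hom2 K f g)"
      using faithful_if_left_inverse_up_to_iso[OF e r \<alpha> f g] by (intro inj_onI) blast
    have into: "id2 K e \<star> \<gamma> \<in> hom2 K (e \<odot> f) (e \<odot> g)" if "\<gamma> \<in> hom2 K f g" for \<gamma>
      using that t by (simp add: hom2_def cell_simps)
    have surj: "\<exists>\<gamma>\<in>hom2 K f g. id2 K e \<star> \<gamma> = \<delta>" if \<delta>: "\<delta> \<in> hom2 K (e \<odot> f) (e \<odot> g)" for \<delta>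
    proof -
      define \<gamma> where "\<gamma> = (\<alpha>' \<star> id2 K g) \<bullet> (id2 K r \<star> \<delta>) \<bullet> (\<alpha> \<star> id2 K f)"
      note t' = t \<delta>[unfolded hom2_def, simplified]
      have \<gamma>: "\<gamma> \<in> hom2 K f g" unfolding \<gamma>_def using t' by (simp add: hom2_def cell_simps)
      note t\<gamma> = \<gamma>[unfolded hom2_def, simplified]
      have invg: "(\<alpha> \<star> id2 K g) \<bullet> (\<alpha>' \<star> id2 K g) = id2 K (r \<odot> e \<odot> g)"
        using inverse_cells_whisker_right[OF \<alpha>, of g] t'
        unfolding inverse_cells_def by (simp add: cell_simps)
      have invf: "(\<alpha> \<star> id2 K f) \<bullet> (\<alpha>' \<star> id2 K f) = id2 K (r \<odot> e \<odot> f)"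
        using inverse_cells_whisker_right[OF \<alpha>, of f] t'
        unfolding inverse_cells_def by (simp add: cell_simps)
      have ex: "(\<alpha> \<star> id2 K g) \<bullet> \<gamma> = (id2 K (r \<odot> e) \<star> \<gamma>) \<bullet> (\<alpha> \<star> id2 K f)"
        using whisker_exchange[OF \<gamma>, of \<alpha> "idn K A" "r \<odot> e"] t t\<gamma>
        by (simp add: hom2_def cell_simps)
      have "id2 K r \<star> (id2 K e \<star> \<gamma>) = (id2 K (r \<odot> e) \<star> \<gamma>) \<bullet> ((\<alpha> \<star> id2 K f) \<bullet> (\<alpha>' \<star> id2 K f))"
        unfolding invf using t t\<gamma> by (simp add: cell_simps)
      also have "\<dots> = ((\<alpha> \<star> id2 K g) \<bullet> \<gamma>) \<bullet> (\<alpha>' \<star> id2 K f)"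
        unfolding ex using t t\<gamma> by (simp add: cell_simps)
      also have "\<dots> = ((\<alpha> \<star> id2 K g) \<bullet> (\<alpha>' \<star> id2 K g)) \<bullet> (id2 K r \<star> \<delta>)
          \<bullet> ((\<alpha> \<star> id2 K f) \<bullet> (\<alpha>' \<star> id2 K f))"
        unfolding \<gamma>_def using t' by (simp add: cell_simps)
      also have "\<dots> = id2 K r \<star> \<delta>"
        unfolding invf invg using t' by (simp add: cell_simps)
      finally have eq: "id2 K r \<star> (id2 K e \<star> \<gamma>) = id2 K r \<star> \<delta>" .
      have "e \<odot> f \<in> hom1 K X B" "e \<odot> g \<in> hom1 K X B"
        using t by (auto simp: hom1_def comp_simps)
      then have "id2 K e \<star> \<gamma> = \<delta>"
        using faithful_if_left_inverse_up_to_iso[OF r e inverse_cells_sym[OF \<beta>] _ _ into[OF \<gamma>] \<delta> eq]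
        by blast
      then show ?thesis using \<gamma> by blast
    qed
    have "bij_betw (\<lambda>\<gamma>. id2 K e \<star> \<gamma>) (hom2 K f g) (hom2 K (e \<odot> f) (e \<odot> g))"
      unfolding bij_betw_def using inj into surj by blast }
  then show ?thesis using e unfolding fully_faithful_def hom1_def by auto
qed

text \<open>
  Take \<open>\<beta>\<close> as counit and define the unit to be the lift of \<open>\<beta>' \<star> e\<close> through \<open>e\<close>. One triangle
  identity then holds by construction, and the other one holds because \<open>e\<close> is faithful. In
  particular every equivalence is part of an adjoint equivalence, in either direction.
\<close>

lemma fully_faithful_left_adjoint_of_section:
  assumes e: "e \<in> hom1 K A B" and r: "r \<in> hom1 K B A" and ff: "fully_faithful K e"
    and \<beta>: "inverse_cells K (e \<odot> r) (idn K B) \<beta> \<beta>'"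
  shows "adjoint K e r"
proof -
  note A = hom1_Obj[OF e]
  note t = e[unfolded hom1_def, simplified] r[unfolded hom1_def, simplified] A
    \<beta>[unfolded inverse_cells_def hom2_def, simplified]
  have lift: "\<beta>' \<star> id2 K e \<in> hom2 K (e \<odot> idn K A) (e \<odot> (r \<odot> e))"
    using t by (simp add: hom2_def cell_simps)
  have ends: "idn K A \<in> hom1 K A (src K e)" "r \<odot> e \<in> hom1 K A (src K e)"
    using t by (auto simp: hom1_def cell_simps)
  obtain \<eta> where \<eta>: "\<eta> \<in> hom2 K (idn K A) (r \<odot> e)" and e\<eta>: "id2 K e \<star> \<eta> = \<beta>' \<star> id2 K e"
    using fully_faithful_lift[OF ff ends lift] .
  note t' = t \<eta>[unfolded hom2_def, simplified]
  have tri1: "(\<beta> \<star> id2 K e) \<bullet> (id2 K e \<star> \<eta>) = id2 K e"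
    using inverse_cells_whisker_right[OF \<beta>, of e] t'
    unfolding e\<eta> inverse_cells_def by (simp add: cell_simps)
  have "id2 K e \<star> ((id2 K r \<star> \<beta>) \<bullet> (\<eta> \<star> id2 K r))
      = (id2 K (e \<odot> r) \<star> \<beta>) \<bullet> ((id2 K e \<star> \<eta>) \<star> id2 K r)"
    using t' by (simp add: cell_simps)
  also have "\<dots> = (id2 K (e \<odot> r) \<star> \<beta>) \<bullet> (\<beta>' \<star> id2 K (e \<odot> r))"
    unfolding e\<eta> using t' by (simp add: cell_simps)
  also have "\<dots> = \<beta>' \<bullet> \<beta>"
    using whisker_exchange[of \<beta> "e \<odot> r" "idn K B" \<beta>' "idn K B" "e \<odot> r"] t'
    by (simp add: hom2_def cell_simps)
  also have "\<dots> = id2 K e \<star> id2 K r" using t' by (simp add: cell_simps)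
  finally have eq: "id2 K e \<star> ((id2 K r \<star> \<beta>) \<bullet> (\<eta> \<star> id2 K r)) = id2 K e \<star> id2 K r" .
  have r': "r \<in> hom1 K B (src K e)" using t by (simp add: hom1_def)
  have tri2: "(id2 K r \<star> \<beta>) \<bullet> (\<eta> \<star> id2 K r) = id2 K r"
    by (rule fully_faithful_cancel[OF ff r' r' _ _ eq]) (use t' in \<open>simp_all add: hom2_def cell_simps\<close>)
  have "adjunction K e r \<eta> \<beta>"
    unfolding adjunction_def using t' tri1 tri2 by (simp add: hom2_def)
  then show ?thesis unfolding adjoint_iff_adjunction by blast
qed


section \<open>Adjunctions\<close>

lemma adjunction_transpose:
  assumes adj: "adjunction K L i \<eta> \<epsilon>"
    and p: "p \<in> hom1 K Z (src K L)" and q: "q \<in> hom1 K Z (src K i)"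
  shows "bij_betw (\<lambda>\<gamma>. (id2 K i \<star> \<gamma>) \<bullet> (\<eta> \<star> id2 K p)) (hom2 K (L \<odot> p) q) (hom2 K p (i \<odot> q))"
proof -
  note t = adj[unfolded adjunction_def hom2_def, simplified]
    p[unfolded hom1_def, simplified] q[unfolded hom1_def, simplified]
  have tri1: "(\<epsilon> \<star> id2 K (L \<odot> p)) \<bullet> (id2 K L \<star> (\<eta> \<star> id2 K p)) = id2 K (L \<odot> p)"
  proof -
    have "(\<epsilon> \<star> id2 K (L \<odot> p)) \<bullet> (id2 K L \<star> (\<eta> \<star> id2 K p))
        = ((\<epsilon> \<star> id2 K L) \<bullet> (id2 K L \<star> \<eta>)) \<star> id2 K p"
      by (subst whisker_right_vcomp) (use t in \<open>simp_all add: cell_simps\<close>)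
    then show ?thesis using t by (simp add: cell_simps)
  qed
  have tri2: "(id2 K i \<star> (\<epsilon> \<star> id2 K q)) \<bullet> (\<eta> \<star> id2 K (i \<odot> q)) = id2 K (i \<odot> q)"
  proof -
    have "(id2 K i \<star> (\<epsilon> \<star> id2 K q)) \<bullet> (\<eta> \<star> id2 K (i \<odot> q))
        = ((id2 K i \<star> \<epsilon>) \<bullet> (\<eta> \<star> id2 K i)) \<star> id2 K q"
      by (subst whisker_right_vcomp) (use t in \<open>simp_all add: cell_simps\<close>)
    then show ?thesis using t by (simp add: cell_simps)
  qed
  have left_inv: "(\<epsilon> \<star> id2 K q) \<bullet> (id2 K L \<star> ((id2 K i \<star> \<gamma>) \<bullet> (\<eta> \<star> id2 K p))) = \<gamma>"
    if \<gamma>: "\<gamma> \<in> hom2 K (L \<odot> p) q" for \<gamma>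
  proof -
    note t' = t \<gamma>[unfolded hom2_def, simplified]
    have ex: "(\<epsilon> \<star> id2 K q) \<bullet> (id2 K (L \<odot> i) \<star> \<gamma>) = \<gamma> \<bullet> (\<epsilon> \<star> id2 K (L \<odot> p))"
      using whisker_exchange[OF \<gamma>, of \<epsilon> "L \<odot> i" "idn K (src K i)"] t'
      by (simp add: hom2_def cell_simps)
    have "(\<epsilon> \<star> id2 K q) \<bullet> (id2 K L \<star> ((id2 K i \<star> \<gamma>) \<bullet> (\<eta> \<star> id2 K p)))
        = ((\<epsilon> \<star> id2 K q) \<bullet> (id2 K (L \<odot> i) \<star> \<gamma>)) \<bullet> (id2 K L \<star> (\<eta> \<star> id2 K p))"
      using t' by (simp add: cell_simps)
    also have "\<dots> = \<gamma> \<bullet> ((\<epsilon> \<star> id2 K (L \<odot> p)) \<bullet> (id2 K L \<star> (\<eta> \<star> id2 K p)))"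
      unfolding ex using t' by (simp add: cell_simps)
    also have "\<dots> = \<gamma>" unfolding tri1 using t' by (simp add: cell_simps)
    finally show ?thesis .
  qed
  have right_inv: "(id2 K i \<star> ((\<epsilon> \<star> id2 K q) \<bullet> (id2 K L \<star> \<delta>))) \<bullet> (\<eta> \<star> id2 K p) = \<delta>"
    if \<delta>: "\<delta> \<in> hom2 K p (i \<odot> q)" for \<delta>
  proof -
    note t' = t \<delta>[unfolded hom2_def, simplified]
    have ex: "(id2 K (i \<odot> L) \<star> \<delta>) \<bullet> (\<eta> \<star> id2 K p) = (\<eta> \<star> id2 K (i \<odot> q)) \<bullet> \<delta>"
      using whisker_exchange[OF \<delta>, of \<eta> "idn K (src K L)" "i \<odot> L"] t'
      by (simp add: hom2_def cell_simps)
    have "(id2 K i \<star> ((\<epsilon> \<star> id2 K q) \<bullet> (id2 K L \<star> \<delta>))) \<bullet> (\<eta> \<star> id2 K p)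
        = (id2 K i \<star> (\<epsilon> \<star> id2 K q)) \<bullet> ((id2 K (i \<odot> L) \<star> \<delta>) \<bullet> (\<eta> \<star> id2 K p))"
      using t' by (simp add: cell_simps)
    also have "\<dots> = ((id2 K i \<star> (\<epsilon> \<star> id2 K q)) \<bullet> (\<eta> \<star> id2 K (i \<odot> q))) \<bullet> \<delta>"
      unfolding ex using t' by (simp add: cell_simps)
    also have "\<dots> = \<delta>" unfolding tri2 using t' by (simp add: cell_simps)
    finally show ?thesis .
  qed
  show ?thesis
  proof (rule bij_betw_byWitness[where f' = "\<lambda>\<delta>. (\<epsilon> \<star> id2 K q) \<bullet> (id2 K L \<star> \<delta>)"])
    show "(\<lambda>\<gamma>. (id2 K i \<star> \<gamma>) \<bullet> (\<eta> \<star> id2 K p)) ` hom2 K (L \<odot> p) q \<subseteq> hom2 K p (i \<odot> q)"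
      "(\<lambda>\<delta>. (\<epsilon> \<star> id2 K q) \<bullet> (id2 K L \<star> \<delta>)) ` hom2 K p (i \<odot> q) \<subseteq> hom2 K (L \<odot> p) q"
      using t by (auto simp: hom2_def cell_simps)
  qed (use left_inv right_inv in auto)
qed

text \<open>
  Precomposition turns \<open>L \<stileturn> R\<close> around: \<open>(\<lambda>p. p \<odot> R)\<close> is left adjoint to \<open>(\<lambda>q. q \<odot> L)\<close>.
\<close>

lemma adjunction_precomp_transpose:
  assumes adj: "adjunction K L R \<eta> \<epsilon>"
    and p: "p \<in> hom1 K (src K L) Z" and q: "q \<in> hom1 K (src K R) Z"
  shows "bij_betw (\<lambda>\<gamma>. (\<gamma> \<star> id2 K L) \<bullet> (id2 K p \<star> \<eta>)) (hom2 K (p \<odot> R) q) (hom2 K p (q \<odot> L))"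
proof -
  note t = adj[unfolded adjunction_def hom2_def, simplified]
    p[unfolded hom1_def, simplified] q[unfolded hom1_def, simplified]
  have tri2: "(id2 K (p \<odot> R) \<star> \<epsilon>) \<bullet> (id2 K p \<star> (\<eta> \<star> id2 K R)) = id2 K (p \<odot> R)"
  proof -
    have "(id2 K (p \<odot> R) \<star> \<epsilon>) \<bullet> (id2 K p \<star> (\<eta> \<star> id2 K R))
        = id2 K p \<star> ((id2 K R \<star> \<epsilon>) \<bullet> (\<eta> \<star> id2 K R))"
      by (subst whisker_left_vcomp) (use t in \<open>simp_all add: cell_simps\<close>)
    then show ?thesis using t by (simp add: cell_simps)
  qed
  have tri1: "(id2 K q \<star> (\<epsilon> \<star> id2 K L)) \<bullet> (id2 K (q \<odot> L) \<star> \<eta>) = id2 K (q \<odot> L)"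
  proof -
    have "(id2 K q \<star> (\<epsilon> \<star> id2 K L)) \<bullet> (id2 K (q \<odot> L) \<star> \<eta>)
        = id2 K q \<star> ((\<epsilon> \<star> id2 K L) \<bullet> (id2 K L \<star> \<eta>))"
      by (subst whisker_left_vcomp) (use t in \<open>simp_all add: cell_simps\<close>)
    then show ?thesis using t by (simp add: cell_simps)
  qed
  have left_inv: "(id2 K q \<star> \<epsilon>) \<bullet> (((\<gamma> \<star> id2 K L) \<bullet> (id2 K p \<star> \<eta>)) \<star> id2 K R) = \<gamma>"
    if \<gamma>: "\<gamma> \<in> hom2 K (p \<odot> R) q" for \<gamma>
  proof -
    note t' = t \<gamma>[unfolded hom2_def, simplified]
    have ex: "(id2 K q \<star> \<epsilon>) \<bullet> (\<gamma> \<star> id2 K (L \<odot> R)) = \<gamma> \<bullet> (id2 K (p \<odot> R) \<star> \<epsilon>)"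
      using whisker_exchange[of \<epsilon> "L \<odot> R" "idn K (src K R)" \<gamma> "p \<odot> R" q] t'
      by (simp add: hom2_def cell_simps)
    have "(id2 K q \<star> \<epsilon>) \<bullet> (((\<gamma> \<star> id2 K L) \<bullet> (id2 K p \<star> \<eta>)) \<star> id2 K R)
        = ((id2 K q \<star> \<epsilon>) \<bullet> (\<gamma> \<star> id2 K (L \<odot> R))) \<bullet> (id2 K p \<star> (\<eta> \<star> id2 K R))"
      using t' by (simp add: cell_simps)
    also have "\<dots> = \<gamma> \<bullet> ((id2 K (p \<odot> R) \<star> \<epsilon>) \<bullet> (id2 K p \<star> (\<eta> \<star> id2 K R)))"
      unfolding ex using t' by (simp add: cell_simps)
    also have "\<dots> = \<gamma>" unfolding tri2 using t' by (simp add: cell_simps)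
    finally show ?thesis .
  qed
  have right_inv: "(((id2 K q \<star> \<epsilon>) \<bullet> (\<delta> \<star> id2 K R)) \<star> id2 K L) \<bullet> (id2 K p \<star> \<eta>) = \<delta>"
    if \<delta>: "\<delta> \<in> hom2 K p (q \<odot> L)" for \<delta>
  proof -
    note t' = t \<delta>[unfolded hom2_def, simplified]
    have ex: "(\<delta> \<star> id2 K (R \<odot> L)) \<bullet> (id2 K p \<star> \<eta>) = (id2 K (q \<odot> L) \<star> \<eta>) \<bullet> \<delta>"
      using whisker_exchange[of \<eta> "idn K (src K L)" "R \<odot> L" \<delta> p "q \<odot> L"] t'
      by (simp add: hom2_def cell_simps)
    have "(((id2 K q \<star> \<epsilon>) \<bullet> (\<delta> \<star> id2 K R)) \<star> id2 K L) \<bullet> (id2 K p \<star> \<eta>)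
        = (id2 K q \<star> (\<epsilon> \<star> id2 K L)) \<bullet> ((\<delta> \<star> id2 K (R \<odot> L)) \<bullet> (id2 K p \<star> \<eta>))"
      using t' by (simp add: cell_simps)
    also have "\<dots> = ((id2 K q \<star> (\<epsilon> \<star> id2 K L)) \<bullet> (id2 K (q \<odot> L) \<star> \<eta>)) \<bullet> \<delta>"
      unfolding ex using t' by (simp add: cell_simps)
    also have "\<dots> = \<delta>" unfolding tri1 using t' by (simp add: cell_simps)
    finally show ?thesis .
  qed
  show ?thesis
  proof (rule bij_betw_byWitness[where f' = "\<lambda>\<delta>. (id2 K q \<star> \<epsilon>) \<bullet> (\<delta> \<star> id2 K R)"])
    show "(\<lambda>\<gamma>. (\<gamma> \<star> id2 K L) \<bullet> (id2 K p \<star> \<eta>)) ` hom2 K (p \<odot> R) q \<subseteq> hom2 K p (q \<odot> L)"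
      "(\<lambda>\<delta>. (id2 K q \<star> \<epsilon>) \<bullet> (\<delta> \<star> id2 K R)) ` hom2 K p (q \<odot> L) \<subseteq> hom2 K (p \<odot> R) q"
      using t by (auto simp: hom2_def cell_simps)
  qed (use left_inv right_inv in auto)
qed

text \<open>
  The inverse of the counit is the lift through \<open>i\<close> of \<open>\<eta> \<star> i : i \<Rightarrow> i \<odot> L \<odot> i\<close>. One composite
  is a triangle identity seen through the faithful \<open>i\<close>; the other is an endomorphism of \<open>L \<odot> i\<close>
  with the same transpose \<open>\<eta> \<star> i\<close> as the identity.
\<close>

lemma counit_invertible_if_right_adjoint_fully_faithful:
  assumes adj: "adjunction K L i \<eta> \<epsilon>" and ff: "fully_faithful K i"
  obtains \<delta> where "inverse_cells K (L \<odot> i) (idn K (src K i)) \<epsilon> \<delta>"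
proof -
  note t = adj[unfolded adjunction_def hom2_def, simplified]
  have h: "idn K (src K i) \<in> hom1 K (src K i) (src K i)" "L \<odot> i \<in> hom1 K (src K i) (src K i)"
    using t by (auto simp: hom1_def cell_simps)
  have lift: "\<eta> \<star> id2 K i \<in> hom2 K (i \<odot> idn K (src K i)) (i \<odot> (L \<odot> i))"
    using t by (simp add: hom2_def cell_simps)
  obtain \<delta> where \<delta>: "\<delta> \<in> hom2 K (idn K (src K i)) (L \<odot> i)" and i\<delta>: "id2 K i \<star> \<delta> = \<eta> \<star> id2 K i"
    using fully_faithful_lift[OF ff h lift] .
  note t' = t \<delta>[unfolded hom2_def, simplified]
  have "id2 K i \<star> (\<epsilon> \<bullet> \<delta>) = (id2 K i \<star> \<epsilon>) \<bullet> (id2 K i \<star> \<delta>)"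
    using t' by (simp add: cell_simps)
  also have "\<dots> = id2 K i \<star> id2 K (idn K (src K i))"
    unfolding i\<delta> using t' by (simp add: cell_simps)
  finally have eq: "id2 K i \<star> (\<epsilon> \<bullet> \<delta>) = id2 K i \<star> id2 K (idn K (src K i))" .
  have 1: "\<epsilon> \<bullet> \<delta> = id2 K (idn K (src K i))"
    by (rule fully_faithful_cancel[OF ff h(1) h(1) _ _ eq])
      (use t' in \<open>simp_all add: hom2_def cell_simps\<close>)
  have i: "i \<in> hom1 K (src K i) (src K L)" using t by (simp add: hom1_def)
  have "(id2 K i \<star> (\<delta> \<bullet> \<epsilon>)) \<bullet> (\<eta> \<star> id2 K i)
      = (id2 K i \<star> \<delta>) \<bullet> ((id2 K i \<star> \<epsilon>) \<bullet> (\<eta> \<star> id2 K i))"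
    using t' by (simp add: cell_simps)
  also have "\<dots> = \<eta> \<star> id2 K i"
    unfolding i\<delta> using t' by (simp add: cell_simps)
  also have "\<dots> = (id2 K i \<star> id2 K (L \<odot> i)) \<bullet> (\<eta> \<star> id2 K i)"
    using t' by (simp add: cell_simps)
  finally have "(id2 K i \<star> (\<delta> \<bullet> \<epsilon>)) \<bullet> (\<eta> \<star> id2 K i)
      = (id2 K i \<star> id2 K (L \<odot> i)) \<bullet> (\<eta> \<star> id2 K i)" .
  moreover have "\<delta> \<bullet> \<epsilon> \<in> hom2 K (L \<odot> i) (L \<odot> i)" "id2 K (L \<odot> i) \<in> hom2 K (L \<odot> i) (L \<odot> i)"
    using t' by (simp_all add: hom2_def cell_simps)
  ultimately have 2: "\<delta> \<bullet> \<epsilon> = id2 K (L \<odot> i)"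
    using adjunction_transpose[OF adj i h(2)] unfolding bij_betw_def inj_on_def by blast
  have "inverse_cells K (L \<odot> i) (idn K (src K i)) \<epsilon> \<delta>"
    using 1 2 t' by (simp add: inverse_cells_def hom2_def)
  then show ?thesis using that by blast
qed


section \<open>Left extensions\<close>

lemma is_lan_cancel:
  assumes "is_lan K j f l \<eta>" "g \<in> hom1 K (trg K j) (trg K f)" "\<beta> \<in> hom2 K l g" "\<beta>' \<in> hom2 K l g"
    "(\<beta> \<star> id2 K j) \<bullet> \<eta> = (\<beta>' \<star> id2 K j) \<bullet> \<eta>"
  shows "\<beta> = \<beta>'"
  using assms unfolding is_lan_def bij_betw_def inj_on_def by blast

lemma is_lan_factor:
  assumes "is_lan K j f l \<eta>" "g \<in> hom1 K (trg K j) (trg K f)" "\<gamma> \<in> hom2 K f (g \<odot> j)"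
  obtains \<beta> where "\<beta> \<in> hom2 K l g" "(\<beta> \<star> id2 K j) \<bullet> \<eta> = \<gamma>"
proof -
  have "\<gamma> \<in> (\<lambda>\<beta>. (\<beta> \<star> id2 K j) \<bullet> \<eta>) ` hom2 K l g"
    using assms unfolding is_lan_def bij_betw_def by simp
  then show ?thesis using that by blast
qed

lemma is_lan_unique:
  assumes l: "is_lan K j f l \<eta>" and l': "is_lan K j f l' \<eta>'"
  obtains \<theta> \<theta>' where "inverse_cells K l l' \<theta> \<theta>'" "(\<theta> \<star> id2 K j) \<bullet> \<eta> = \<eta>'"
proof -
  have hl: "l \<in> hom1 K (trg K j) (trg K f)" "\<eta> \<in> hom2 K f (l \<odot> j)" "j \<in> Arr K" "f \<in> hom1 K (src K j) (trg K f)"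
    and hl': "l' \<in> hom1 K (trg K j) (trg K f)" "\<eta>' \<in> hom2 K f (l' \<odot> j)"
    using l l' unfolding is_lan_def by auto
  obtain \<theta> where \<theta>: "\<theta> \<in> hom2 K l l'" "(\<theta> \<star> id2 K j) \<bullet> \<eta> = \<eta>'"
    using is_lan_factor[OF l hl'] .
  obtain \<theta>' where \<theta>': "\<theta>' \<in> hom2 K l' l" "(\<theta>' \<star> id2 K j) \<bullet> \<eta>' = \<eta>"
    using is_lan_factor[OF l' hl(1,2)] .
  have t: "l \<in> Arr K" "src K l = trg K j" "trg K l = trg K f" "l' \<in> Arr K" "src K l' = trg K j"
    "trg K l' = trg K f" "j \<in> Arr K" "f \<in> Arr K" "src K f = src K j"
    "\<eta> \<in> Cell K" "dom2 K \<eta> = f" "cod2 K \<eta> = l \<odot> j" "\<eta>' \<in> Cell K" "dom2 K \<eta>' = f" "cod2 K \<eta>' = l' \<odot> j"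
    "\<theta> \<in> Cell K" "dom2 K \<theta> = l" "cod2 K \<theta> = l'" "\<theta>' \<in> Cell K" "dom2 K \<theta>' = l'" "cod2 K \<theta>' = l"
    using hl hl' \<theta>(1) \<theta>'(1) unfolding hom1_def hom2_def by auto
  have 1: "\<theta>' \<bullet> \<theta> = id2 K l"
  proof (rule is_lan_cancel[OF l hl(1)])
    have "((\<theta>' \<bullet> \<theta>) \<star> id2 K j) \<bullet> \<eta> = (\<theta>' \<star> id2 K j) \<bullet> ((\<theta> \<star> id2 K j) \<bullet> \<eta>)"
      using t by (simp add: cell_simps)
    also have "\<dots> = (id2 K l \<star> id2 K j) \<bullet> \<eta>"
      unfolding \<theta>(2) \<theta>'(2) using t by (simp add: cell_simps)
    finally show "((\<theta>' \<bullet> \<theta>) \<star> id2 K j) \<bullet> \<eta> = (id2 K l \<star> id2 K j) \<bullet> \<eta>" .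
  qed (use t in \<open>simp_all add: hom2_def cell_simps\<close>)
  have 2: "\<theta> \<bullet> \<theta>' = id2 K l'"
  proof (rule is_lan_cancel[OF l' hl'(1)])
    have "((\<theta> \<bullet> \<theta>') \<star> id2 K j) \<bullet> \<eta>' = (\<theta> \<star> id2 K j) \<bullet> ((\<theta>' \<star> id2 K j) \<bullet> \<eta>')"
      using t by (simp add: cell_simps)
    also have "\<dots> = (id2 K l' \<star> id2 K j) \<bullet> \<eta>'"
      unfolding \<theta>(2) \<theta>'(2) using t by (simp add: cell_simps)
    finally show "((\<theta> \<bullet> \<theta>') \<star> id2 K j) \<bullet> \<eta>' = (id2 K l' \<star> id2 K j) \<bullet> \<eta>'" .
  qed (use t in \<open>simp_all add: hom2_def cell_simps\<close>)
  show ?thesis using that[of \<theta> \<theta>'] \<theta> \<theta>' 1 2 unfolding inverse_cells_def by blast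
qed

text \<open>
  Both the extended 1-cell and the extension may be replaced by isomorphic ones: the comparison map
  is composed with the bijections given by precomposition with \<open>\<theta>\<close> and with \<open>\<phi>\<close>.
\<close>

lemma is_lan_cong_iso:
  assumes l: "is_lan K j f l \<eta>"
    and \<phi>: "inverse_cells K f' f \<phi> \<phi>'" and \<theta>: "inverse_cells K l l' \<theta> \<theta>'"
  shows "is_lan K j f' l' ((\<theta> \<star> id2 K j) \<bullet> \<eta> \<bullet> \<phi>)"
proof -
  have t: "l \<in> Arr K" "src K l = trg K j" "trg K l = trg K f" "j \<in> Arr K" "f \<in> Arr K"
    "src K f = src K j" "\<eta> \<in> Cell K" "dom2 K \<eta> = f" "cod2 K \<eta> = l \<odot> j"
    "l' \<in> Arr K" "src K l' = trg K j" "trg K l' = trg K f"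
    "f' \<in> Arr K" "src K f' = src K j" "trg K f' = trg K f"
    "\<phi> \<in> Cell K" "dom2 K \<phi> = f'" "cod2 K \<phi> = f" "\<theta> \<in> Cell K" "dom2 K \<theta> = l" "cod2 K \<theta> = l'"
    using l \<phi> \<theta> inverse_cells_Arr[OF \<phi>] inverse_cells_Arr[OF \<theta>]
    unfolding is_lan_def inverse_cells_def hom1_def hom2_def by auto
  have bij: "bij_betw (\<lambda>\<beta>. (\<beta> \<star> id2 K j) \<bullet> ((\<theta> \<star> id2 K j) \<bullet> \<eta> \<bullet> \<phi>)) (hom2 K l' g) (hom2 K f' (g \<odot> j))"
    if g: "g \<in> hom1 K (trg K j) (trg K f)" for g
  proof -
    have "bij_betw (\<lambda>\<beta>. (\<beta> \<star> id2 K j) \<bullet> \<eta>) (hom2 K l g) (hom2 K f (g \<odot> j))"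
      using l g unfolding is_lan_def by blast
    from bij_betw_trans[OF bij_betw_trans[OF inverse_cells_precomp_bij[OF \<theta>, of g] this]
        inverse_cells_precomp_bij[OF \<phi>, of "g \<odot> j"]]
    show ?thesis
    proof (rule bij_betw_cong[THEN iffD1, rotated])
      fix \<beta> assume "\<beta> \<in> hom2 K l' g"
      then show "((\<lambda>\<psi>. \<psi> \<bullet> \<phi>) \<circ> ((\<lambda>\<beta>. (\<beta> \<star> id2 K j) \<bullet> \<eta>) \<circ> (\<lambda>\<psi>. \<psi> \<bullet> \<theta>))) \<beta>
          = (\<beta> \<star> id2 K j) \<bullet> ((\<theta> \<star> id2 K j) \<bullet> \<eta> \<bullet> \<phi>)"
        using t g by (simp add: hom1_def hom2_def cell_simps)
    qed
  qed
  show ?thesis unfolding is_lan_def using t bij by (simp add: hom1_def hom2_def cell_simps)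
qed

text \<open>
  Preservation does not depend on the choice of the extension. This matters because admissibility
  and cocompleteness only provide some extension, while the arguments below are about a particular
  one.
\<close>

lemma preserves_lan_any:
  assumes k: "preserves_lan K k j f l \<eta>" and l: "is_lan K j f l \<eta>" and l': "is_lan K j f l' \<eta>'"
  shows "preserves_lan K k j f l' \<eta>'"
proof -
  obtain \<theta> \<theta>' where \<theta>: "inverse_cells K l l' \<theta> \<theta>'" and eq: "(\<theta> \<star> id2 K j) \<bullet> \<eta> = \<eta>'"
    using is_lan_unique[OF l l'] .
  have t: "l \<in> Arr K" "src K l = trg K j" "trg K l = trg K f" "j \<in> Arr K" "f \<in> Arr K"
    "src K f = src K j" "\<eta> \<in> Cell K" "dom2 K \<eta> = f" "cod2 K \<eta> = l \<odot> j"
    "\<theta> \<in> Cell K" "dom2 K \<theta> = l" "cod2 K \<theta> = l'" "k \<in> Arr K" "src K k = trg K f"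
    using l \<theta> k inverse_cells_Arr[OF \<theta>]
    unfolding preserves_lan_def is_lan_def inverse_cells_def hom1_def hom2_def by auto
  have "inverse_cells K (k \<odot> l) (k \<odot> l') (id2 K k \<star> \<theta>) (id2 K k \<star> \<theta>')"
    using t by (intro inverse_cells_whisker_left[OF \<theta>]) auto
  moreover have "is_lan K j (k \<odot> f) (k \<odot> l) (id2 K k \<star> \<eta>)" using k unfolding preserves_lan_def by blast
  moreover have "inverse_cells K (k \<odot> f) (k \<odot> f) (id2 K (k \<odot> f)) (id2 K (k \<odot> f))"
    using t by (intro inverse_cells_id2) (simp add: comp_simps)
  ultimately have "is_lan K j (k \<odot> f) (k \<odot> l')
      (((id2 K k \<star> \<theta>) \<star> id2 K j) \<bullet> (id2 K k \<star> \<eta>) \<bullet> id2 K (k \<odot> f))"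
    using is_lan_cong_iso by blast
  moreover have "((id2 K k \<star> \<theta>) \<star> id2 K j) \<bullet> (id2 K k \<star> \<eta>) \<bullet> id2 K (k \<odot> f) = id2 K k \<star> \<eta>'"
    unfolding eq[symmetric] using t by (simp add: cell_simps)
  ultimately show ?thesis using t unfolding preserves_lan_def by simp
qed

lemma preserves_lan_cong_iso:
  assumes k: "preserves_lan K k j f l \<eta>" and l: "is_lan K j f l \<eta>"
    and \<kappa>: "inverse_cells K k k' \<kappa> \<kappa>'"
  shows "preserves_lan K k' j f l \<eta>"
proof -
  have t: "l \<in> Arr K" "src K l = trg K j" "trg K l = trg K f" "j \<in> Arr K" "f \<in> Arr K"
    "src K f = src K j" "\<eta> \<in> Cell K" "dom2 K \<eta> = f" "cod2 K \<eta> = l \<odot> j"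
    "\<kappa> \<in> Cell K" "dom2 K \<kappa> = k" "cod2 K \<kappa> = k'" "\<kappa>' \<in> Cell K" "dom2 K \<kappa>' = k'" "cod2 K \<kappa>' = k"
    "k \<in> Arr K" "src K k = trg K f" "k' \<in> Arr K" "src K k' = trg K f" "trg K k' = trg K k"
    using l k \<kappa> inverse_cells_Arr[OF \<kappa>]
    unfolding preserves_lan_def is_lan_def inverse_cells_def hom1_def hom2_def by auto
  have \<kappa>f: "inverse_cells K (k \<odot> f) (k' \<odot> f) (\<kappa> \<star> id2 K f) (\<kappa>' \<star> id2 K f)"
    using t by (intro inverse_cells_whisker_right[OF \<kappa>]) auto
  have \<kappa>l: "inverse_cells K (k \<odot> l) (k' \<odot> l) (\<kappa> \<star> id2 K l) (\<kappa>' \<star> id2 K l)"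
    using t by (intro inverse_cells_whisker_right[OF \<kappa>]) auto
  have "is_lan K j (k' \<odot> f) (k' \<odot> l)
      (((\<kappa> \<star> id2 K l) \<star> id2 K j) \<bullet> (id2 K k \<star> \<eta>) \<bullet> (\<kappa>' \<star> id2 K f))"
    using is_lan_cong_iso[OF _ inverse_cells_sym[OF \<kappa>f] \<kappa>l] k unfolding preserves_lan_def by blast
  moreover have "((\<kappa> \<star> id2 K l) \<star> id2 K j) \<bullet> (id2 K k \<star> \<eta>) \<bullet> (\<kappa>' \<star> id2 K f) = id2 K k' \<star> \<eta>"
  proof -
    have ex: "(\<kappa> \<star> id2 K (l \<odot> j)) \<bullet> (id2 K k \<star> \<eta>) = (id2 K k' \<star> \<eta>) \<bullet> (\<kappa> \<star> id2 K f)"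
      by (rule whisker_exchange) (use t in \<open>simp_all add: hom2_def\<close>)
    have "((\<kappa> \<star> id2 K l) \<star> id2 K j) \<bullet> (id2 K k \<star> \<eta>) \<bullet> (\<kappa>' \<star> id2 K f)
        = ((\<kappa> \<star> id2 K (l \<odot> j)) \<bullet> (id2 K k \<star> \<eta>)) \<bullet> (\<kappa>' \<star> id2 K f)"
      using t by (simp add: cell_simps)
    also have "\<dots> = (id2 K k' \<star> \<eta>) \<bullet> ((\<kappa> \<star> id2 K f) \<bullet> (\<kappa>' \<star> id2 K f))"
      unfolding ex using t by (simp add: cell_simps)
    also have "(\<kappa> \<star> id2 K f) \<bullet> (\<kappa>' \<star> id2 K f) = id2 K (k' \<odot> f)"
      using \<kappa>f unfolding inverse_cells_def by blast
    finally show ?thesis using t by (simp add: cell_simps)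
  qed
  ultimately show ?thesis using t unfolding preserves_lan_def by simp
qed

lemma preserves_lan_comp:
  assumes l: "is_lan K j f l \<eta>" and k: "preserves_lan K k j f l \<eta>"
    and m: "preserves_lan K m j (k \<odot> f) (k \<odot> l) (id2 K k \<star> \<eta>)"
  shows "preserves_lan K (m \<odot> k) j f l \<eta>"
proof -
  have t: "l \<in> Arr K" "src K l = trg K j" "trg K l = trg K f" "j \<in> Arr K" "f \<in> Arr K"
    "src K f = src K j" "\<eta> \<in> Cell K" "dom2 K \<eta> = f" "cod2 K \<eta> = l \<odot> j"
    "k \<in> Arr K" "src K k = trg K f" "m \<in> Arr K" "src K m = trg K (k \<odot> f)"
    using l k m unfolding preserves_lan_def is_lan_def hom1_def hom2_def by auto
  then have m': "src K m = trg K k" by (simp add: comp_simps)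
  have "is_lan K j (m \<odot> (k \<odot> f)) (m \<odot> (k \<odot> l)) (id2 K m \<star> (id2 K k \<star> \<eta>))"
    using m unfolding preserves_lan_def by blast
  then show ?thesis using t m' unfolding preserves_lan_def by (simp add: cell_simps)
qed

text \<open>
  For \<open>g\<close> into the codomain of \<open>L\<close>, transposition identifies 2-cells \<open>L \<odot> l \<Rightarrow> g\<close> with 2-cells
  \<open>l \<Rightarrow> i \<odot> g\<close>, the universal property identifies these with \<open>f \<Rightarrow> i \<odot> g \<odot> j\<close>, and transposing
  back gives \<open>L \<odot> f \<Rightarrow> g \<odot> j\<close>. By naturality of the unit the composite is pasting with
  \<open>L \<star> \<eta>\<close>.
\<close>

lemma left_adjoint_preserves_lan:
  assumes adj: "adjunction K L i u v" and l: "is_lan K j f l \<eta>" and L: "src K L = trg K f"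
  shows "preserves_lan K L j f l \<eta>"
proof -
  have t: "l \<in> Arr K" "src K l = trg K j" "trg K l = trg K f" "j \<in> Arr K" "f \<in> Arr K"
    "src K f = src K j" "\<eta> \<in> Cell K" "dom2 K \<eta> = f" "cod2 K \<eta> = l \<odot> j"
    using l unfolding is_lan_def hom1_def hom2_def by auto
  note t = t L adj[unfolded adjunction_def hom2_def, simplified]
  have bij: "bij_betw (\<lambda>\<beta>. (\<beta> \<star> id2 K j) \<bullet> (id2 K L \<star> \<eta>)) (hom2 K (L \<odot> l) g) (hom2 K (L \<odot> f) (g \<odot> j))"
    if g: "g \<in> hom1 K (trg K j) (trg K L)" for g
  proof -
    note tg = t g[unfolded hom1_def, simplified]
    let ?T = "\<lambda>p \<gamma>. (id2 K i \<star> \<gamma>) \<bullet> (u \<star> id2 K p)"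
    let ?E = "\<lambda>\<beta>. (\<beta> \<star> id2 K j) \<bullet> \<eta>"
    let ?F = "\<lambda>\<beta>. (\<beta> \<star> id2 K j) \<bullet> (id2 K L \<star> \<eta>)"
    have Tl: "bij_betw (?T l) (hom2 K (L \<odot> l) g) (hom2 K l (i \<odot> g))"
      by (rule adjunction_transpose[OF adj, of _ "trg K j"]) (use tg in \<open>simp_all add: hom1_def\<close>)
    have E: "bij_betw ?E (hom2 K l (i \<odot> g)) (hom2 K f ((i \<odot> g) \<odot> j))"
      using l tg unfolding is_lan_def by (simp add: hom1_def comp_simps)
    have Tf: "bij_betw (?T f) (hom2 K (L \<odot> f) (g \<odot> j)) (hom2 K f (i \<odot> (g \<odot> j)))"
      by (rule adjunction_transpose[OF adj, of _ "src K j"]) (use tg in \<open>simp_all add: hom1_def comp_simps\<close>)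
    have assoc: "(i \<odot> g) \<odot> j = i \<odot> (g \<odot> j)" using tg by (simp add: cell_simps)
    have into: "?F ` hom2 K (L \<odot> l) g \<subseteq> hom2 K (L \<odot> f) (g \<odot> j)"
      using tg by (auto simp: hom2_def cell_simps)
    have comm: "(?E \<circ> ?T l) \<beta> = (?T f \<circ> ?F) \<beta>" if \<beta>: "\<beta> \<in> hom2 K (L \<odot> l) g" for \<beta>
    proof -
      note tb = tg \<beta>[unfolded hom2_def, simplified]
      have ex: "(u \<star> id2 K (l \<odot> j)) \<bullet> \<eta> = (id2 K (i \<odot> L) \<star> \<eta>) \<bullet> (u \<star> id2 K f)"
        using whisker_exchange[of \<eta> f "l \<odot> j" u "idn K (src K L)" "i \<odot> L"] tg
        by (simp add: hom2_def cell_simps)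
      have "(?E \<circ> ?T l) \<beta> = (id2 K i \<star> (\<beta> \<star> id2 K j)) \<bullet> ((u \<star> id2 K (l \<odot> j)) \<bullet> \<eta>)"
        using tb by (simp add: cell_simps)
      also have "\<dots> = (?T f \<circ> ?F) \<beta>"
        unfolding ex using tb by (simp add: cell_simps)
      finally show ?thesis .
    qed
    have "bij_betw (?E \<circ> ?T l) (hom2 K (L \<odot> l) g) (hom2 K f (i \<odot> (g \<odot> j)))"
      using bij_betw_trans[OF Tl E] unfolding assoc .
    then have "bij_betw (?T f \<circ> ?F) (hom2 K (L \<odot> l) g) (hom2 K f (i \<odot> (g \<odot> j)))"
      using comm bij_betw_cong by blast
    then show ?thesis using bij_betw_comp_iff2[OF Tf into] by blast
  qed
  show ?thesis unfolding preserves_lan_def is_lan_def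
    using t bij by (simp add: hom1_def hom2_def cell_simps)
qed

text \<open>
  Extending along \<open>E\<close> is precomposing with \<open>R\<close>, by \<open>adjunction_precomp_transpose\<close>; so an extension
  along \<open>E \<odot> j\<close> is computed by extending along \<open>j\<close> first.
\<close>

lemma is_lan_along_left_adjoint_comp:
  assumes adj: "adjunction K E R u v" and l: "is_lan K j f l \<eta>" and E: "src K E = trg K j"
  shows "is_lan K (E \<odot> j) f (l \<odot> R) ((id2 K l \<star> (u \<star> id2 K j)) \<bullet> \<eta>)"
proof -
  have t: "l \<in> Arr K" "src K l = trg K j" "trg K l = trg K f" "j \<in> Arr K" "f \<in> Arr K"
    "src K f = src K j" "\<eta> \<in> Cell K" "dom2 K \<eta> = f" "cod2 K \<eta> = l \<odot> j"
    using l unfolding is_lan_def hom1_def hom2_def by auto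
  note t = t E adj[unfolded adjunction_def hom2_def, simplified]
  have bij: "bij_betw (\<lambda>\<beta>. (\<beta> \<star> id2 K (E \<odot> j)) \<bullet> (id2 K l \<star> (u \<star> id2 K j)) \<bullet> \<eta>)
      (hom2 K (l \<odot> R) g) (hom2 K f (g \<odot> (E \<odot> j)))"
    if g: "g \<in> hom1 K (trg K E) (trg K f)" for g
  proof -
    note tg = t g[unfolded hom1_def, simplified]
    have T: "bij_betw (\<lambda>\<gamma>. (\<gamma> \<star> id2 K E) \<bullet> (id2 K l \<star> u)) (hom2 K (l \<odot> R) g) (hom2 K l (g \<odot> E))"
      by (rule adjunction_precomp_transpose[OF adj, of _ "trg K f"]) (use tg in \<open>simp_all add: hom1_def\<close>)
    have "bij_betw (\<lambda>\<beta>. (\<beta> \<star> id2 K j) \<bullet> \<eta>) (hom2 K l (g \<odot> E)) (hom2 K f ((g \<odot> E) \<odot> j))"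
      using l tg unfolding is_lan_def by (simp add: hom1_def comp_simps)
    moreover have "(g \<odot> E) \<odot> j = g \<odot> (E \<odot> j)" using tg by (simp add: cell_simps)
    ultimately have "bij_betw ((\<lambda>\<beta>. (\<beta> \<star> id2 K j) \<bullet> \<eta>) \<circ> (\<lambda>\<gamma>. (\<gamma> \<star> id2 K E) \<bullet> (id2 K l \<star> u)))
        (hom2 K (l \<odot> R) g) (hom2 K f (g \<odot> (E \<odot> j)))"
      using bij_betw_trans[OF T] by simp
    then show ?thesis
    proof (rule bij_betw_cong[THEN iffD1, rotated])
      fix \<beta> assume "\<beta> \<in> hom2 K (l \<odot> R) g"
      then show "((\<lambda>\<beta>. (\<beta> \<star> id2 K j) \<bullet> \<eta>) \<circ> (\<lambda>\<gamma>. (\<gamma> \<star> id2 K E) \<bullet> (id2 K l \<star> u))) \<beta>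
          = (\<beta> \<star> id2 K (E \<odot> j)) \<bullet> (id2 K l \<star> (u \<star> id2 K j)) \<bullet> \<eta>"
        using tg by (simp add: hom2_def cell_simps)
    qed
  qed
  show ?thesis unfolding is_lan_def
    using t bij by (simp add: hom1_def hom2_def cell_simps)
qed

section \<open>Cocomplete objects\<close>

lemma kz_doctrine_ext:
  assumes "kz_doctrine K D" "f \<in> hom1 K A (on_obj D B)" "B \<in> Obj K"
  shows "is_lan K (unit_of D A) f (ext D B f) (ext_cell D B f)" "invertible2 K (ext_cell D B f)"
  using assms hom1_Obj(1)[OF assms(2)] unfolding kz_doctrine_def by blast+

lemma kz_doctrine_free_cocomplete:
  assumes D: "kz_doctrine K D" and C: "C \<in> Obj K"
  shows "cocomplete K D (on_obj D C)"
  unfolding cocomplete_def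
proof (intro conjI ballI)
  show "on_obj D C \<in> Obj K" using D C unfolding kz_doctrine_def by blast
  fix B g assume B: "B \<in> Obj K" and g: "g \<in> hom1 K B (on_obj D C)"
  have "preserves_lan K (ext D C g) (unit_of D A) f (ext D B f) (ext_cell D B f)"
    if "A \<in> Obj K" "f \<in> hom1 K A (on_obj D B)" for A f
    using D B C g that unfolding kz_doctrine_def by blast
  then show "\<exists>l \<eta>. is_lan K (unit_of D B) g l \<eta> \<and> invertible2 K \<eta> \<and>
      (\<forall>A \<in> Obj K. \<forall>f \<in> hom1 K A (on_obj D B).
        preserves_lan K l (unit_of D A) f (ext D B f) (ext_cell D B f))"
    using kz_doctrine_ext[OF D g C] by blast
qed

text \<open>
  The extension of \<open>g : B \<rightarrow> src i\<close> is \<open>L \<odot> l\<close>, where \<open>l\<close> extends \<open>i \<odot> g\<close>; invertibility of the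
  counit makes it an extension of \<open>g\<close> itself rather than of \<open>L \<odot> i \<odot> g\<close>.
\<close>

lemma cocomplete_reflective:
  assumes D: "kz_doctrine K D" and adj: "adjunction K L i \<eta> \<epsilon>" and ff: "fully_faithful K i"
    and X: "cocomplete K D (src K L)"
  shows "cocomplete K D (src K i)"
  unfolding cocomplete_def
proof (intro conjI ballI)
  note t = adj[unfolded adjunction_def hom2_def, simplified]
  show "src K i \<in> Obj K" using t by (simp add: cell_simps)
  obtain \<delta> where \<delta>: "inverse_cells K (L \<odot> i) (idn K (src K i)) \<epsilon> \<delta>"
    using counit_invertible_if_right_adjoint_fully_faithful[OF adj ff] .
  fix B g assume B: "B \<in> Obj K" and g: "g \<in> hom1 K B (src K i)"
  note tg = t g[unfolded hom1_def, simplified]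
  have "i \<odot> g \<in> hom1 K B (src K L)" using tg by (simp add: hom1_def cell_simps)
  then obtain l c where l: "is_lan K (unit_of D B) (i \<odot> g) l c" and c: "invertible2 K c"
    and pres: "\<And>A f. \<lbrakk>A \<in> Obj K; f \<in> hom1 K A (on_obj D B)\<rbrakk> \<Longrightarrow>
        preserves_lan K l (unit_of D A) f (ext D B f) (ext_cell D B f)"
    using X B unfolding cocomplete_def by blast
  let ?s = "unit_of D B"
  have tl: "l \<in> Arr K" "src K l = trg K ?s" "trg K l = src K L" "?s \<in> Arr K" "src K ?s = B"
    "c \<in> Cell K" "dom2 K c = i \<odot> g" "cod2 K c = l \<odot> ?s"
    using l tg unfolding is_lan_def hom1_def hom2_def by (auto simp: comp_simps)
  obtain c' where c': "inverse_cells K (i \<odot> g) (l \<odot> ?s) c c'"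
    using c invertible2_iff_inverse_cells[of c K "i \<odot> g" "l \<odot> ?s"] tl unfolding hom2_def by auto
  have Ll: "is_lan K ?s (L \<odot> (i \<odot> g)) (L \<odot> l) (id2 K L \<star> c)"
    using left_adjoint_preserves_lan[OF adj l] tg unfolding preserves_lan_def
    by (simp add: comp_simps)
  \<comment> \<open>The counit identifies \<open>L \<odot> (i \<odot> g)\<close> with \<open>g\<close>.\<close>
  have \<delta>g: "inverse_cells K g (L \<odot> (i \<odot> g)) (\<delta> \<star> id2 K g) (\<epsilon> \<star> id2 K g)"
    using inverse_cells_whisker_right[OF inverse_cells_sym[OF \<delta>], of g] tg
    by (simp add: cell_simps)
  have lan: "is_lan K ?s g (L \<odot> l) ((id2 K L \<star> c) \<bullet> (\<delta> \<star> id2 K g))"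
  proof -
    have "inverse_cells K (L \<odot> l) (L \<odot> l) (id2 K (L \<odot> l)) (id2 K (L \<odot> l))"
      using tl tg by (intro inverse_cells_id2) (simp add: comp_simps)
    from is_lan_cong_iso[OF Ll \<delta>g this]
    have "is_lan K ?s g (L \<odot> l)
        ((id2 K (L \<odot> l) \<star> id2 K ?s) \<bullet> (id2 K L \<star> c) \<bullet> (\<delta> \<star> id2 K g))" .
    moreover have "(id2 K (L \<odot> l) \<star> id2 K ?s) \<bullet> (id2 K L \<star> c) \<bullet> (\<delta> \<star> id2 K g)
        = (id2 K L \<star> c) \<bullet> (\<delta> \<star> id2 K g)"
      using tl tg \<delta>[unfolded inverse_cells_def hom2_def, simplified] by (simp add: cell_simps)
    ultimately show ?thesis by simp
  qed
  have inv: "invertible2 K ((id2 K L \<star> c) \<bullet> (\<delta> \<star> id2 K g))"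
  proof -
    have "inverse_cells K (L \<odot> (i \<odot> g)) (L \<odot> (l \<odot> ?s)) (id2 K L \<star> c) (id2 K L \<star> c')"
      using tg by (intro inverse_cells_whisker_left[OF c']) (simp_all add: comp_simps)
    from inverse_cells_vcomp[OF \<delta>g this] show ?thesis by (rule inverse_cells_invertible2)
  qed
  have pres': "preserves_lan K (L \<odot> l) (unit_of D A) f (ext D B f) (ext_cell D B f)"
    if A: "A \<in> Obj K" and f: "f \<in> hom1 K A (on_obj D B)" for A f
  proof (rule preserves_lan_comp)
    show lan: "is_lan K (unit_of D A) f (ext D B f) (ext_cell D B f)"
      using kz_doctrine_ext(1)[OF D f B] .
    show p: "preserves_lan K l (unit_of D A) f (ext D B f) (ext_cell D B f)"
      using pres[OF A f] .
    have "f \<in> Arr K" "trg K f = src K l"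
      using p f unfolding preserves_lan_def hom1_def by auto
    then show "preserves_lan K L (unit_of D A) (l \<odot> f) (l \<odot> ext D B f) (id2 K l \<star> ext_cell D B f)"
      using p tl by (intro left_adjoint_preserves_lan[OF adj])
        (simp_all add: preserves_lan_def comp_simps)
  qed
  show "\<exists>l \<eta>. is_lan K (unit_of D B) g l \<eta> \<and> invertible2 K \<eta> \<and>
      (\<forall>A \<in> Obj K. \<forall>f \<in> hom1 K A (on_obj D B).
        preserves_lan K l (unit_of D A) f (ext D B f) (ext_cell D B f))"
    using lan inv pres' by blast
qed

text \<open>
  Cocompleteness asserts preservation only for some extension of \<open>g\<close> and for the extensions chosen
  by the doctrine; uniqueness of extensions transfers it to all of them.
\<close>

lemma extension_into_cocomplete_preserves_lan:
  assumes D: "kz_doctrine K D" and X: "cocomplete K D X" and B: "B \<in> Obj K"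
    and g: "g \<in> hom1 K B X" and l: "is_lan K (unit_of D B) g l \<eta>"
    and f: "f \<in> hom1 K A (on_obj D B)" and m: "is_lan K (unit_of D A) f m \<mu>"
  shows "preserves_lan K l (unit_of D A) f m \<mu>"
proof -
  obtain l' \<eta>' where l': "is_lan K (unit_of D B) g l' \<eta>'"
    and pres: "preserves_lan K l' (unit_of D A) f (ext D B f) (ext_cell D B f)"
    using X B g f hom1_Obj(1)[OF f] unfolding cocomplete_def by blast
  obtain \<theta> \<theta>' where "inverse_cells K l' l \<theta> \<theta>'" using is_lan_unique[OF l' l] .
  then have "preserves_lan K l (unit_of D A) f (ext D B f) (ext_cell D B f)"
    using preserves_lan_cong_iso[OF pres kz_doctrine_ext(1)[OF D f B]] by blast
  then show ?thesis using preserves_lan_any[OF _ kz_doctrine_ext(1)[OF D f B] m] by blast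
qed


section \<open>Realization and nerve\<close>

text \<open>
  Here \<open>H\<close> is the realization of \<open>h\<close> and \<open>N\<close> its nerve. Since \<open>H\<close> preserves the extension \<open>N\<close>, the
  composite \<open>H \<odot> N\<close> extends \<open>H \<odot> y \<cong> h\<close> along \<open>h\<close>, so a 2-cell out of it, such as the counit,
  is determined by a 2-cell out of \<open>h\<close>. The unit is a 2-cell out of the identity, which by density
  of \<open>y\<close> is the extension of \<open>y\<close> along itself.
\<close>

lemma realization_adjoint_nerve:
  assumes H: "is_lan K y h H c" and c: "inverse_cells K h (H \<odot> y) c c'"
    and N: "is_lan K h y N \<chi>" and pres: "preserves_lan K H h y N \<chi>"
    and dense: "is_lan K y y (idn K (trg K y)) (id2 K y)"
  shows "adjoint K H N"
proof -
  have t: "y \<in> Arr K" "h \<in> Arr K" "src K h = src K y" "H \<in> Arr K" "src K H = trg K y"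
    "trg K H = trg K h" "N \<in> Arr K" "src K N = trg K h" "trg K N = trg K y"
    "c \<in> Cell K" "dom2 K c = h" "cod2 K c = H \<odot> y" "\<chi> \<in> Cell K" "dom2 K \<chi> = y" "cod2 K \<chi> = N \<odot> h"
    "c' \<in> Cell K" "dom2 K c' = H \<odot> y" "cod2 K c' = h"
    using H N c unfolding is_lan_def inverse_cells_def hom1_def hom2_def by auto
  have HN: "is_lan K h (H \<odot> y) (H \<odot> N) (id2 K H \<star> \<chi>)"
    using pres unfolding preserves_lan_def by blast
  have c'c: "c' \<bullet> c = id2 K h" "c \<bullet> c' = id2 K (H \<odot> y)" using c unfolding inverse_cells_def by auto

  \<comment> \<open>The counit corresponds to \<open>c' : H \<odot> y \<Rightarrow> h\<close>, the unit to \<open>y \<Rightarrow> N \<odot> h \<Rightarrow> N \<odot> H \<odot> y\<close>.\<close>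
  have "idn K (trg K h) \<in> hom1 K (trg K h) (trg K (H \<odot> y))"
    using t by (simp add: hom1_def cell_simps)
  moreover have "c' \<in> hom2 K (H \<odot> y) (idn K (trg K h) \<odot> h)"
    using t by (simp add: hom2_def cell_simps)
  ultimately obtain \<epsilon> where \<epsilon>: "\<epsilon> \<in> hom2 K (H \<odot> N) (idn K (trg K h))"
    and \<epsilon>h: "(\<epsilon> \<star> id2 K h) \<bullet> (id2 K H \<star> \<chi>) = c'"
    by (rule is_lan_factor[OF HN])
  have "N \<odot> H \<in> hom1 K (trg K y) (trg K y)"
    using t by (simp add: hom1_def cell_simps)
  moreover have "(id2 K N \<star> c) \<bullet> \<chi> \<in> hom2 K y ((N \<odot> H) \<odot> y)"
    using t by (simp add: hom2_def cell_simps)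
  ultimately obtain \<eta> where \<eta>: "\<eta> \<in> hom2 K (idn K (trg K y)) (N \<odot> H)"
    and \<eta>y: "(\<eta> \<star> id2 K y) \<bullet> id2 K y = (id2 K N \<star> c) \<bullet> \<chi>"
    by (rule is_lan_factor[OF dense])
  note t' = t \<epsilon>[unfolded hom2_def, simplified] \<eta>[unfolded hom2_def, simplified]
  have \<eta>y: "\<eta> \<star> id2 K y = (id2 K N \<star> c) \<bullet> \<chi>"
    using \<eta>y t' by (simp add: cell_simps)

  \<comment> \<open>Both triangle identities are checked after restriction along the extension that defines
    their domain.\<close>
  have "(((\<epsilon> \<star> id2 K H) \<bullet> (id2 K H \<star> \<eta>)) \<star> id2 K y) \<bullet> c = (id2 K H \<star> id2 K y) \<bullet> c"
  proof -
    have ex: "(\<epsilon> \<star> id2 K (H \<odot> y)) \<bullet> (id2 K (H \<odot> N) \<star> c) = c \<bullet> (\<epsilon> \<star> id2 K h)"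
      using whisker_exchange[of c h "H \<odot> y" \<epsilon> "H \<odot> N" "idn K (trg K h)"] t'
      by (simp add: hom2_def cell_simps)
    have "(((\<epsilon> \<star> id2 K H) \<bullet> (id2 K H \<star> \<eta>)) \<star> id2 K y) \<bullet> c
        = (\<epsilon> \<star> id2 K (H \<odot> y)) \<bullet> (id2 K H \<star> (\<eta> \<star> id2 K y)) \<bullet> c"
      using t' by (simp add: cell_simps)
    also have "\<dots> = ((\<epsilon> \<star> id2 K (H \<odot> y)) \<bullet> (id2 K (H \<odot> N) \<star> c)) \<bullet> (id2 K H \<star> \<chi>) \<bullet> c"
      unfolding \<eta>y using t' by (simp add: cell_simps)
    also have "\<dots> = c \<bullet> ((\<epsilon> \<star> id2 K h) \<bullet> (id2 K H \<star> \<chi>)) \<bullet> c"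
      unfolding ex using t' by (simp add: cell_simps)
    also have "\<dots> = (id2 K H \<star> id2 K y) \<bullet> c"
      unfolding \<epsilon>h c'c using t' by (simp add: cell_simps)
    finally show ?thesis .
  qed
  then have tri1: "(\<epsilon> \<star> id2 K H) \<bullet> (id2 K H \<star> \<eta>) = id2 K H"
    by (rule is_lan_cancel[OF H, of H, rotated 3]) (use t' in \<open>simp_all add: hom1_def hom2_def cell_simps\<close>)
  have "(((id2 K N \<star> \<epsilon>) \<bullet> (\<eta> \<star> id2 K N)) \<star> id2 K h) \<bullet> \<chi> = (id2 K N \<star> id2 K h) \<bullet> \<chi>"
  proof -
    have ex: "(\<eta> \<star> id2 K (N \<odot> h)) \<bullet> \<chi> = (id2 K (N \<odot> H) \<star> \<chi>) \<bullet> (\<eta> \<star> id2 K y)"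
      using whisker_exchange[of \<chi> y "N \<odot> h" \<eta> "idn K (trg K y)" "N \<odot> H"] t'
      by (simp add: hom2_def cell_simps)
    have "(((id2 K N \<star> \<epsilon>) \<bullet> (\<eta> \<star> id2 K N)) \<star> id2 K h) \<bullet> \<chi>
        = (id2 K N \<star> (\<epsilon> \<star> id2 K h)) \<bullet> ((\<eta> \<star> id2 K (N \<odot> h)) \<bullet> \<chi>)"
      using t' by (simp add: cell_simps)
    also have "\<dots> = (id2 K N \<star> ((\<epsilon> \<star> id2 K h) \<bullet> (id2 K H \<star> \<chi>))) \<bullet> (id2 K N \<star> c) \<bullet> \<chi>"
      unfolding ex \<eta>y using t' by (simp add: cell_simps)
    also have "\<dots> = (id2 K N \<star> (c' \<bullet> c)) \<bullet> \<chi>"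
      unfolding \<epsilon>h using t' by (simp add: cell_simps)
    also have "\<dots> = (id2 K N \<star> id2 K h) \<bullet> \<chi>" unfolding c'c ..
    finally show ?thesis .
  qed
  then have tri2: "(id2 K N \<star> \<epsilon>) \<bullet> (\<eta> \<star> id2 K N) = id2 K N"
    by (rule is_lan_cancel[OF N, of N, rotated 3]) (use t' in \<open>simp_all add: hom1_def hom2_def cell_simps\<close>)
  have "adjunction K H N \<eta> \<epsilon>"
    unfolding adjunction_def using t' tri1 tri2 by (simp add: hom2_def)
  then show ?thesis unfolding adjoint_iff_adjunction by blast
qed

text \<open>
  Pettiness of \<open>G\<close> makes \<open>h\<close> admissible, which is what provides the preservation hypothesis of
  \<open>realization_adjoint_nerve\<close> for the realization of \<open>h\<close> in a cocomplete object.
\<close>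

lemma petit_nerve_right_adjoint:
  assumes P: "kz_doctrine K P" and G: "petit K P G" and A: "cocomplete K P A"
    and h: "h \<in> hom1 K G A" and N: "is_lan K h (unit_of P G) N \<chi>"
  obtains H where "H \<in> hom1 K (on_obj P G) A" "adjoint K H N"
proof -
  have G': "G \<in> Obj K" using G unfolding petit_def by blast
  have y: "unit_of P G \<in> hom1 K G (on_obj P G)" using P G' unfolding kz_doctrine_def by blast
  obtain H c where H: "is_lan K (unit_of P G) h H c" and c: "invertible2 K c"
    using A G' h unfolding cocomplete_def by blast
  have th: "src K h = G" "trg K h = A" "trg K (unit_of P G) = on_obj P G"
    using h y unfolding hom1_def by auto
  have "c \<in> hom2 K h (H \<odot> unit_of P G)" using H unfolding is_lan_def by blast
  from invertible2_iff_inverse_cells[THEN iffD1, OF this c]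
  obtain c' where c': "inverse_cells K h (H \<odot> unit_of P G) c c'" by blast
  have "admissible K P h" using G h hom1_Obj(2)[OF h] unfolding petit_def by blast
  then obtain n \<nu> where n: "is_lan K h (unit_of P G) n \<nu>" and "preserves_lan K H h (unit_of P G) n \<nu>"
    unfolding admissible_def th using A h H by blast
  then have pres: "preserves_lan K H h (unit_of P G) N \<chi>" using preserves_lan_any N by blast
  have "is_lan K (unit_of P G) (unit_of P G) (idn K (trg K (unit_of P G))) (id2 K (unit_of P G))"
    using kz_doctrine_ext(1)[OF P y G'] P G' th unfolding kz_doctrine_def by simp
  then have "adjoint K H N" using realization_adjoint_nerve[OF H c' N pres] by blast
  moreover have "H \<in> hom1 K (on_obj P G) A" using H th unfolding is_lan_def by simp
  ultimately show ?thesis using that by blast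
qed


section \<open>Presentable objects\<close>

lemma equivalent_adjoints:
  assumes "equivalent K A B"
  obtains e r where "e \<in> hom1 K A B" "r \<in> hom1 K B A" "fully_faithful K e" "adjoint K e r" "adjoint K r e"
proof -
  obtain e r \<alpha> \<beta> where e: "e \<in> hom1 K A B" and r: "r \<in> hom1 K B A"
    and "\<alpha> \<in> hom2 K (idn K A) (r \<odot> e)" "invertible2 K \<alpha>"
    and "\<beta> \<in> hom2 K (e \<odot> r) (idn K B)" "invertible2 K \<beta>"
    using assms unfolding equivalent_def by blast
  then obtain \<alpha>' \<beta>' where \<alpha>: "inverse_cells K (idn K A) (r \<odot> e) \<alpha> \<alpha>'"
    and \<beta>: "inverse_cells K (e \<odot> r) (idn K B) \<beta> \<beta>'"
    using invertible2_iff_inverse_cells by metis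
  have ff: "fully_faithful K e" using equivalence_fully_faithful[OF e r \<alpha> \<beta>] .
  have ff': "fully_faithful K r"
    using equivalence_fully_faithful[OF r e inverse_cells_sym[OF \<beta>] inverse_cells_sym[OF \<alpha>]] .
  show ?thesis
    using that[OF e r ff] fully_faithful_left_adjoint_of_section[OF e r ff \<beta>]
      fully_faithful_left_adjoint_of_section[OF r e ff' inverse_cells_sym[OF \<alpha>]] by blast
qed

lemma cocomplete_accessible_presentable:
  assumes ctx: "kz_context K P S \<upsilon>" and coc: "cocomplete K P A" and acc: "accessible K P S A"
  shows "presentable K P S A"
proof -
  have P: "kz_doctrine K P" and S: "kz_doctrine K S" using ctx unfolding kz_context_def by auto
  obtain G where G: "petit K P G" and eqv: "equivalent K A (on_obj S G)"
    using acc unfolding accessible_def by blast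
  obtain e r where e: "e \<in> hom1 K A (on_obj S G)" and r: "r \<in> hom1 K (on_obj S G) A"
    and ff_e: "fully_faithful K e" and er: "adjoint K e r" and re: "adjoint K r e"
    using equivalent_adjoints[OF eqv] .
  obtain u v where er: "adjunction K e r u v" using er unfolding adjoint_iff_adjunction by blast
  obtain u' v' where re: "adjunction K r e u' v'" using re unfolding adjoint_iff_adjunction by blast
  have G': "G \<in> Obj K" using G unfolding petit_def by blast
  let ?y = "unit_of P G" and ?s = "unit_of S G" and ?i = "\<upsilon> G \<odot> e"
  have y: "?y \<in> hom1 K G (on_obj P G)" and s: "?s \<in> hom1 K G (on_obj S G)"
    using P S G' unfolding kz_doctrine_def by auto
  obtain \<eta> where \<upsilon>: "is_lan K ?s ?y (\<upsilon> G) \<eta>" and ff_\<upsilon>: "fully_faithful K (\<upsilon> G)"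
    using ctx G' unfolding kz_context_def by blast
  have t: "e \<in> Arr K" "src K e = A" "trg K e = on_obj S G" "r \<in> Arr K" "src K r = on_obj S G"
    "trg K r = A" "?s \<in> Arr K" "src K ?s = G" "trg K ?s = on_obj S G" "?y \<in> Arr K" "src K ?y = G"
    "trg K ?y = on_obj P G" "\<upsilon> G \<in> Arr K" "src K (\<upsilon> G) = on_obj S G" "trg K (\<upsilon> G) = on_obj P G"
    using e r y s \<upsilon> unfolding is_lan_def hom1_def by auto
  have i: "?i \<in> hom1 K A (on_obj P G)" using t by (simp add: hom1_def comp_simps)
  have ff: "fully_faithful K ?i" using fully_faithful_comp[OF ff_e ff_\<upsilon>] t by simp

  \<comment> \<open>Working with \<open>r \<odot> \<sigma>\<close> into \<open>A\<close> instead of \<open>\<sigma>\<close> into \<open>S G\<close> uses the cocompleteness of \<open>A\<close>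
    directly, without transporting it along the equivalence.\<close>
  have "r \<odot> ?s \<in> hom1 K G A" using t by (simp add: hom1_def comp_simps)
  moreover have "is_lan K (r \<odot> ?s) ?y ?i ((id2 K (\<upsilon> G) \<star> (u' \<star> id2 K ?s)) \<bullet> \<eta>)"
    using is_lan_along_left_adjoint_comp[OF re \<upsilon>] t by simp
  ultimately obtain L where L: "L \<in> hom1 K (on_obj P G) A" and "adjoint K L ?i"
    using petit_nerve_right_adjoint[OF P G coc] by blast
  then obtain u'' v'' where adj: "adjunction K L ?i u'' v''" unfolding adjoint_iff_adjunction by blast

  have coc_PG: "cocomplete K S (on_obj P G)" using ctx G' unfolding kz_context_def by blast
  have "cocontinuous K S ?i"
    unfolding cocontinuous_def
  proof (intro conjI ballI allI impI)
    show "?i \<in> Arr K" "cocomplete K S (trg K ?i)"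
      using i coc_PG unfolding hom1_def by auto
    have "src K L = on_obj P G" using L unfolding hom1_def by auto
    then show "cocomplete K S (src K ?i)"
      using cocomplete_reflective[OF S adj ff] coc_PG by simp
    fix B f l \<mu> assume f: "f \<in> hom1 K B (src K ?i)" and l: "is_lan K (unit_of S B) f l \<mu>"
    have tf: "f \<in> Arr K" "src K f = B" "trg K f = A" using f t by (simp_all add: hom1_def comp_simps)
    have pe: "preserves_lan K e (unit_of S B) f l \<mu>"
      using left_adjoint_preserves_lan[OF er l] t tf by simp
    have "e \<odot> f \<in> hom1 K B (on_obj S G)" using t tf by (simp add: hom1_def comp_simps)
    moreover have "is_lan K (unit_of S B) (e \<odot> f) (e \<odot> l) (id2 K e \<star> \<mu>)"
      using pe unfolding preserves_lan_def by blast
    ultimately have "preserves_lan K (\<upsilon> G) (unit_of S B) (e \<odot> f) (e \<odot> l) (id2 K e \<star> \<mu>)"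
      using extension_into_cocomplete_preserves_lan[OF S coc_PG G' y \<upsilon>] by blast
    then show "preserves_lan K ?i (unit_of S B) f l \<mu>" by (rule preserves_lan_comp[OF l pe])
  qed
  then show ?thesis
    unfolding presentable_def adjoint_iff_adjunction using acc G L i adj ff by blast
qed

lemma presentable_cocomplete:
  assumes P: "kz_doctrine K P" and A: "presentable K P S A"
  shows "cocomplete K P A"
proof -
  obtain G L i \<eta> \<epsilon> where G: "petit K P G" and L: "L \<in> hom1 K (on_obj P G) A"
    and i: "i \<in> hom1 K A (on_obj P G)" and adj: "adjunction K L i \<eta> \<epsilon>" and ff: "fully_faithful K i"
    using A unfolding presentable_def adjoint_iff_adjunction by blast
  have "G \<in> Obj K" using G unfolding petit_def by blast
  then have "cocomplete K P (src K L)"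
    using kz_doctrine_free_cocomplete[OF P] L unfolding hom1_def by auto
  then show ?thesis
    using cocomplete_reflective[OF P adj ff] i unfolding hom1_def by auto
qed

end

theorem theorem2p43:
  fixes K :: "('o, 'm, 'c) twocat"
    and P S :: "('o, 'm, 'c) doctrine"
    and \<upsilon> :: "'o \<Rightarrow> 'm"
    and A :: 'o
  assumes "two_category K"
    and "kz_context K P S \<upsilon>"
    and "A \<in> Obj K"
  shows "cocomplete K P A \<and> accessible K P S A \<longleftrightarrow> presentable K P S A"
proof
  assume "cocomplete K P A \<and> accessible K P S A"
  then show "presentable K P S A"
    using two_category.cocomplete_accessible_presentable[OF assms(1,2)] by blast
next
  assume A: "presentable K P S A"
  have "kz_doctrine K P" using assms(2) unfolding kz_context_def by blast
  then show "cocomplete K P A \<and> accessible K P S A"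
    using two_category.presentable_cocomplete[OF assms(1) _ A] A unfolding presentable_def by blast
qed

end
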